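(* Let $n=n_1+n_2$ with $n_1,n_2$ positive integers, and let $X=(X_1,\ldots,X_n)$ be an $n$-dimensional centered Gaussian vector. Then for any $t_1,\ldots,t_n>0$, $$\mathbb{P}(|X_1|\leq t_1,\ldots,|X_n|\leq t_n)\geq \mathbb{P}(|X_1|\leq t_1,\ldots,|X_{n_1}|\leq t_{n_1})\,\mathbb{P}(|X_{n_1+1}|\leq t_{n_1+1},\ldots,|X_n|\leq t_n).$$
   Context: A centered Gaussian vector is a random vector with a mean-zero (jointly) Gaussian distribution; its covariance matrix may be any symmetric positive semidefinite matrix (degenerate covariance is allowed). *)

theory Defs
  imports "HOL-Probability.Probability"
begin

text \<open>A real random variable with law $N(0,\sigma^2)$ for some $\sigma \ge 0$. The case
  $\sigma = 0$ is the point mass at 0 and is listed separately, because \<^const>\<open>normal_density\<close>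
  is a probability density only for positive standard deviation.\<close>

definition centered_normal_rv :: "'a measure \<Rightarrow> ('a \<Rightarrow> real) \<Rightarrow> bool" where
  "centered_normal_rv M Y \<longleftrightarrow>
     Y \<in> borel_measurable M \<and>
     ((AE \<omega> in M. Y \<omega> = 0) \<or> (\<exists>\<sigma>>0. distributed M lborel Y (normal_density 0 \<sigma>)))"

text \<open>Joint Gaussianity of a finite family, in the usual sense that every linear combination of
  the coordinates is a (possibly degenerate) normal variable. No nondegeneracy is imposed, so the
  covariance matrix may be any symmetric positive semidefinite matrix.\<close>

definition centered_gaussian_vector :: "'a measure \<Rightarrow> 'i set \<Rightarrow> ('i \<Rightarrow> 'a \<Rightarrow> real) \<Rightarrow> bool" where
  "centered_gaussian_vector M I X \<longleftrightarrow>
     finite I \<and> (\<forall>i\<in>I. X i \<in> borel_measurable M) \<and>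
     (\<forall>a :: 'i \<Rightarrow> real. centered_normal_rv M (\<lambda>\<omega>. \<Sum>i\<in>I. a i * X i \<omega>))"

end

theory Submission imports Defs
begin

text \<open>
  This is the Gaussian correlation inequality, proved along the lines of Royen. Let the index set
  be the disjoint union of \<open>A\<close> and \<open>B\<close>, let \<open>C\<close> be the covariance of \<open>X\<close>, and multiply the
  covariances between \<open>A\<close> and \<open>B\<close> by a parameter \<open>\<tau>\<close>. At \<open>\<tau> = 1\<close> this is the law of \<open>X\<close>, at
  \<open>\<tau> = 0\<close> the two blocks are independent, so it suffices that the probability of the box is
  nondecreasing in \<open>\<tau>\<close>.

  Royen differentiates the density of the squares \<open>X\<^sub>i\<^sup>2 / 2\<close>, which is known through its Laplace
  transform. Densities and the inversion of Laplace transforms can be avoided: replace the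
  indicator of the box by a product of functions \<open>p\<^sub>i(exp(-X\<^sub>i\<^sup>2 / 2))\<close>, where the \<open>p\<^sub>i\<close> are
  polynomials that are nonnegative and nondecreasing on \<open>[0, 1]\<close>. The expectation of such a product
  is a finite linear combination of values \<open>L(\<tau>, k) = E exp(- \<Sum> k\<^sub>i X\<^sub>i\<^sup>2 / 2)\<close> at vectors \<open>k\<close> of
  natural numbers. Polynomials of the form \<open>1 - (1 - u^m)^b\<close> approximate indicators of intervals
  \<open>(c, 1]\<close>, and dominated convergence gives the inequality for boxes.

  For nonnegative \<open>l\<close>, \<open>L(\<tau>, l) = D(\<tau>, l) powr (-1/2)\<close> with
  \<open>D(\<tau>, l) = det (1 + diag(l) C\<^sub>\<tau>)\<close>. Two properties of \<open>D\<close> carry the proof: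

    \<^item> \<open>D\<close> is affine in every single \<open>l\<^sub>i\<close>
      (\<open>gauss_det_affine\<close>, by Gaussian elimination of the other variables);
    \<^item> \<open>D\<close> is nonincreasing in \<open>\<tau>\<close> on \<open>[0, 1]\<close> (\<open>gauss_lap_interp_mono\<close>): \<open>L\<close> is a Gaussian
      integral of \<open>exp(-Q / 2) exp(-\<tau> R / 2)\<close> and even in \<open>\<tau>\<close>, hence the integral of
      \<open>exp(-Q / 2) cosh(\<tau> R / 2)\<close>.

  Therefore the derivative of \<open>-D\<close> in \<open>\<tau>\<close> is a combination \<open>\<Sum>\<^sub>J a\<^sub>J \<Prod>\<^sub>i\<^sub>\<in>\<^sub>J l\<^sub>i\<close> with \<open>a\<^sub>J \<ge> 0\<close>
  (\<open>nonneg_multiaffine_expansion\<close>), and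
  \<open>dL/d\<tau> = 1/2 (\<Sum>\<^sub>J a\<^sub>J \<Prod>\<^sub>i\<^sub>\<in>\<^sub>J l\<^sub>i) L^3\<close>. The cube of \<open>L\<close> is the transform of three independent
  copies of the vector, and the factor \<open>k\<^sub>i\<close> turns \<open>p\<^sub>i(u)\<close> into \<open>u p\<^sub>i'(u)\<close>. So the derivative
  of the expectation is a nonnegative combination of expectations of products of the nonnegative
  numbers \<open>p\<^sub>i(u)\<close> and \<open>u p\<^sub>i'(u)\<close> (\<open>moment_cube_sum_nonneg\<close>).
\<close>

section \<open>Gaussian integrals of exponentials of quadratic forms\<close>

text \<open>
Completing the square; this is one step of Gaussian elimination.
\<close>
lemma integral_std_normal_exp_quadratic:
  fixes a b c :: real
  assumes a: "0 \<le> a"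
  shows "(\<integral>x. exp (- (a * x\<^sup>2 + 2 * b * x + c) / 2) \<partial>std_normal_distribution)
       = exp (- (c - b\<^sup>2 / (1 + a)) / 2) / sqrt (1 + a)"
proof -
  define K where "K = exp (- (c - b\<^sup>2 / (1 + a)) / 2) / sqrt (1 + a)"
  have pos: "0 < 1 + a" using a by simp
  have eq: "std_normal_density x *\<^sub>R exp (- (a * x\<^sup>2 + 2 * b * x + c) / 2)
      = K * normal_density (- b / (1 + a)) (1 / sqrt (1 + a)) x" for x
  proof -
    have "- x\<^sup>2 / 2 + - (a * x\<^sup>2 + 2 * b * x + c) / 2
        = - (c - b\<^sup>2 / (1 + a)) / 2 + - (x - - b / (1 + a))\<^sup>2 / (2 * (1 / sqrt (1 + a))\<^sup>2)"
      using pos by (simp add: power_divide divide_simps) (simp add: field_simps power2_eq_square)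
    then have "exp (- x\<^sup>2 / 2) * exp (- (a * x\<^sup>2 + 2 * b * x + c) / 2)
        = exp (- (c - b\<^sup>2 / (1 + a)) / 2) * exp (- (x - - b / (1 + a))\<^sup>2 / (2 * (1 / sqrt (1 + a))\<^sup>2))"
      by (metis exp_add)
    moreover have "sqrt (2 * pi * (1 / sqrt (1 + a))\<^sup>2) = sqrt (2 * pi) / sqrt (1 + a)"
      using pos by (simp add: real_sqrt_divide power_divide real_sqrt_mult)
    ultimately show ?thesis
      using pos unfolding K_def normal_density_def by (simp add: field_simps)
  qed
  have "(\<integral>x. exp (- (a * x\<^sup>2 + 2 * b * x + c) / 2) \<partial>std_normal_distribution)
      = (\<integral>x. std_normal_density x *\<^sub>R exp (- (a * x\<^sup>2 + 2 * b * x + c) / 2) \<partial>lborel)"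
    by (rule integral_density) auto
  also have "\<dots> = (\<integral>x. K * normal_density (- b / (1 + a)) (1 / sqrt (1 + a)) x \<partial>lborel)"
    unfolding eq ..
  also have "\<dots> = K" using pos by simp
  finally show ?thesis unfolding K_def .
qed

definition qform :: "'i set \<Rightarrow> ('i \<Rightarrow> 'i \<Rightarrow> real) \<Rightarrow> ('i \<Rightarrow> real) \<Rightarrow> real" where
  "qform I C v = (\<Sum>i\<in>I. \<Sum>j\<in>I. C i j * v i * v j)"

definition psd_on :: "'i set \<Rightarrow> ('i \<Rightarrow> 'i \<Rightarrow> real) \<Rightarrow> bool" where
  "psd_on I C \<longleftrightarrow> (\<forall>i\<in>I. \<forall>j\<in>I. C i j = C j i) \<and> (\<forall>v. 0 \<le> qform I C v)"

lemma psd_on_sym: "psd_on I C \<Longrightarrow> i \<in> I \<Longrightarrow> j \<in> I \<Longrightarrow> C i j = C j i"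
  unfolding psd_on_def by blast

lemma psd_on_nonneg: "psd_on I C \<Longrightarrow> 0 \<le> qform I C v"
  unfolding psd_on_def by blast

abbreviation std_gauss :: "'i set \<Rightarrow> ('i \<Rightarrow> real) measure" where
  "std_gauss I \<equiv> Pi\<^sub>M I (\<lambda>_. std_normal_distribution)"

text \<open>
When \<open>C\<close> is the covariance of a centered Gaussian vector \<open>X\<close> and \<open>l \<ge> 0\<close>, this is the expectation of
\<open>exp(- \<Sum> l\<^sub>i X\<^sub>i\<^sup>2 / 2)\<close>, as \<open>integral_exp_neg_squares\<close> shows. Integrating over a standard
Gaussian \<open>y\<close> instead of \<open>X\<close> gives a function of \<open>C\<close> alone with an explicit integrand, also for
singular \<open>C\<close>.
\<close>
definition gauss_lap :: "'i set \<Rightarrow> ('i \<Rightarrow> 'i \<Rightarrow> real) \<Rightarrow> ('i \<Rightarrow> real) \<Rightarrow> real" where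
  "gauss_lap I C l = (\<integral>y. exp (- qform I C (\<lambda>i. sqrt (l i) * y i) / 2) \<partial>std_gauss I)"

lemma prob_space_std_normal: "prob_space std_normal_distribution"
  by (rule prob_space_normal_density) simp

lemma prob_space_std_gauss: "prob_space (std_gauss I)"
  by (intro prob_space_PiM prob_space_std_normal)

lemma product_sigma_finite_std_normal: "product_sigma_finite (\<lambda>_. std_normal_distribution)"
  by (intro product_sigma_finite.intro prob_space_imp_sigma_finite prob_space_std_normal)

lemma qform_cong:
  assumes "\<And>i j. i \<in> I \<Longrightarrow> j \<in> I \<Longrightarrow> C i j = C' i j" "\<And>i. i \<in> I \<Longrightarrow> v i = v' i"
  shows "qform I C v = qform I C' v'"
  unfolding qform_def using assms by (intro sum.cong refl) auto

lemma qform_insert: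
  assumes "finite I" "k \<notin> I" and sym: "\<And>i. i \<in> I \<Longrightarrow> C i k = C k i"
  shows "qform (insert k I) C v = C k k * (v k)\<^sup>2 + 2 * v k * (\<Sum>i\<in>I. C k i * v i) + qform I C v"
proof -
  have "(\<Sum>i\<in>I. C i k * v i * v k) = v k * (\<Sum>i\<in>I. C k i * v i)"
    unfolding sum_distrib_left by (intro sum.cong) (auto simp: sym)
  moreover have "(\<Sum>j\<in>I. C k j * v k * v j) = v k * (\<Sum>i\<in>I. C k i * v i)"
    unfolding sum_distrib_left by (intro sum.cong) auto
  ultimately show ?thesis
    using assms(1,2) unfolding qform_def
    by (simp add: sum.distrib power2_eq_square algebra_simps)
qed

lemma measurable_qform[measurable]:
  assumes "\<And>i. i \<in> I \<Longrightarrow> v i \<in> borel_measurable M"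
  shows "(\<lambda>x. qform I C (\<lambda>i. v i x)) \<in> borel_measurable M"
  unfolding qform_def using assms by measurable

lemma measurable_std_gauss_component:
  "i \<in> I \<Longrightarrow> (\<lambda>y. y i) \<in> borel_measurable (std_gauss I)"
  using measurable_component_singleton[of i I "\<lambda>_. std_normal_distribution"] by simp

lemma measurable_qform_std_gauss:
  "(\<lambda>y. qform I C (\<lambda>i. c i * y i)) \<in> borel_measurable (std_gauss I)"
  by (intro measurable_qform borel_measurable_times borel_measurable_const
      measurable_std_gauss_component)

lemma integrable_gauss_lap:
  assumes "psd_on I C"
  shows "integrable (std_gauss I) (\<lambda>y. exp (- qform I C (\<lambda>i. c i * y i) / 2))"
proof -
  interpret prob_space "std_gauss I" by (rule prob_space_std_gauss)
  show ?thesis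
    using assms measurable_qform_std_gauss[of I C c]
    by (intro integrable_const_bound[where B = 1]) (auto simp: psd_on_def)
qed

lemma gauss_lap_pos:
  assumes "psd_on I C"
  shows "0 < gauss_lap I C l"
proof -
  interpret prob_space "std_gauss I" by (rule prob_space_std_gauss)
  have "gauss_lap I C l \<noteq> 0"
    unfolding gauss_lap_def
    by (subst integral_nonneg_eq_0_iff_AE[OF integrable_gauss_lap[OF assms]]) auto
  moreover have "0 \<le> gauss_lap I C l"
    unfolding gauss_lap_def by simp
  ultimately show ?thesis by simp
qed

lemma gauss_lap_cong:
  assumes "\<And>i j. i \<in> I \<Longrightarrow> j \<in> I \<Longrightarrow> C i j = C' i j" "\<And>i. i \<in> I \<Longrightarrow> l i = l' i"
  shows "gauss_lap I C l = gauss_lap I C' l'"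
  unfolding gauss_lap_def
  by (intro Bochner_Integration.integral_cong refl arg_cong[where f = exp] arg_cong2[where f = "(/)"]
      arg_cong[where f = uminus] qform_cong) (auto simp: assms)

lemma gauss_lap_empty: "gauss_lap {} C l = 1"
proof -
  interpret prob_space "std_gauss {}" by (rule prob_space_std_gauss)
  show ?thesis unfolding gauss_lap_def qform_def by (simp add: prob_space)
qed

text \<open>
Integrating out the coordinate \<open>k\<close> of \<open>y\<close> replaces \<open>C\<close> by this matrix. The square roots in the
definition of \<open>gauss_lap\<close> cancel, so that the entries depend on \<open>l\<close> only through \<open>l k\<close>, and
\<open>l k = 0\<close> needs no separate treatment.
\<close>
definition schur :: "('i \<Rightarrow> real) \<Rightarrow> 'i \<Rightarrow> ('i \<Rightarrow> 'i \<Rightarrow> real) \<Rightarrow> 'i \<Rightarrow> 'i \<Rightarrow> real" where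
  "schur l k C i j = C i j - l k * C k i * C k j / (1 + l k * C k k)"

lemma qform_schur:
  "qform I (schur l k C) v
   = qform I C v - l k * (\<Sum>i\<in>I. C k i * v i)\<^sup>2 / (1 + l k * C k k)"
proof -
  have "qform I C v - qform I (schur l k C) v
      = (\<Sum>i\<in>I. \<Sum>j\<in>I. l k / (1 + l k * C k k) * ((C k i * v i) * (C k j * v j)))"
    unfolding qform_def schur_def
    by (simp add: sum_subtractf[symmetric] algebra_simps)
  also have "\<dots> = l k / (1 + l k * C k k) * (\<Sum>i\<in>I. C k i * v i)\<^sup>2"
    by (simp only: power2_eq_square sum_product) (simp only: sum_distrib_left)
  finally show ?thesis by simp
qed

lemma psd_on_subset:
  assumes "psd_on I C" "J \<subseteq> I" "finite I"
  shows "psd_on J C"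
  unfolding psd_on_def
proof (intro conjI allI)
  show "\<forall>i\<in>J. \<forall>j\<in>J. C i j = C j i" using assms unfolding psd_on_def by blast
  fix v :: "'a \<Rightarrow> real"
  have "qform I C (\<lambda>i. if i \<in> J then v i else 0) = qform J C v"
  proof -
    have "(\<Sum>j\<in>I. C i j * a * (if j \<in> J then v j else 0)) = (\<Sum>j\<in>J. C i j * a * v j)" for i a
      using assms(2,3) by (intro sum.mono_neutral_cong_right) auto
    then show ?thesis unfolding qform_def
      using assms(2,3) finite_subset[OF assms(2,3)] by (simp, intro sum.mono_neutral_cong_right) auto
  qed
  then show "0 \<le> qform J C v" using assms(1) unfolding psd_on_def by metis
qed

lemma psd_on_diag:
  assumes "psd_on I C" "k \<in> I" "finite I"
  shows "0 \<le> C k k"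
proof -
  have "psd_on {k} C" using assms by (auto intro: psd_on_subset[where I = I and J = "{k}"])
  then have "0 \<le> qform {k} C (\<lambda>_. 1)" unfolding psd_on_def by blast
  then show ?thesis by (simp add: qform_def)
qed

text \<open>
Nonnegativity of the original form at a vector whose \<open>k\<close>-th coordinate is chosen nearly
optimally bounds the form of the reduced matrix from below.
\<close>
lemma psd_on_schur:
  assumes psd: "psd_on (insert k I) C" and fin: "finite I" "k \<notin> I" and l: "0 \<le> l k"
  shows "psd_on I (schur l k C)"
  unfolding psd_on_def
proof (intro conjI allI ballI)
  fix i j assume ij: "i \<in> I" "j \<in> I"
  then have "C i j = C j i" by (intro psd_on_sym[OF psd]) auto
  then show "schur l k C i j = schur l k C j i"
    by (simp only: schur_def mult.assoc mult.commute[of "C k i" "C k j"])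
next
  fix v :: "'a \<Rightarrow> real"
  define m where "m = (\<Sum>i\<in>I. C k i * v i)"
  define d where "d = 1 + l k * C k k"
  \<comment> \<open>the minimiser of the form in the coordinate k, with 1 / l k added to the pivot (zero if l k = 0)\<close>
  define s where "s = - l k * m / d"
  have ckk: "0 \<le> C k k" using psd_on_diag[OF psd] fin by simp
  have d: "1 \<le> d" using ckk l unfolding d_def by simp
  let ?v = "v(k := s)"
  have sym: "\<And>i. i \<in> I \<Longrightarrow> C i k = C k i" using psd_on_sym[OF psd] by blast
  have "0 \<le> qform (insert k I) C ?v" by (rule psd_on_nonneg[OF psd])
  also have "\<dots> = C k k * s\<^sup>2 + 2 * s * m + qform I C v"
  proof -
    have "(\<Sum>i\<in>I. C k i * ?v i) = m"
      unfolding m_def using fin by (intro sum.cong) auto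
    moreover have "qform I C ?v = qform I C v"
      using fin by (intro qform_cong) auto
    ultimately show ?thesis using fin by (subst qform_insert) (auto simp: sym)
  qed
  also have "\<dots> = qform I C v - l k * m\<^sup>2 / d - l k * (m / d)\<^sup>2"
  proof -
    have "C k k * s\<^sup>2 = (l k * C k k) * (l k * (m / d)\<^sup>2)"
      unfolding s_def by (simp add: power2_eq_square)
    also have "\<dots> = d * (l k * (m / d)\<^sup>2) - l k * (m / d)\<^sup>2"
      unfolding d_def by (simp add: algebra_simps)
    also have "d * (l k * (m / d)\<^sup>2) = l k * m\<^sup>2 / d"
      using d by (simp add: power2_eq_square)
    finally show ?thesis
      unfolding s_def by (simp add: power2_eq_square)
  qed
  also have "\<dots> \<le> qform I C v - l k * m\<^sup>2 / d"
    using l by simp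
  also have "\<dots> = qform I (schur l k C) v" unfolding qform_schur m_def d_def ..
  finally show "0 \<le> qform I (schur l k C) v" .
qed

lemma gauss_lap_insert:
  assumes psd: "psd_on (insert k I) C" and fin: "finite I" "k \<notin> I" and l: "0 \<le> l k"
  shows "gauss_lap (insert k I) C l = gauss_lap I (schur l k C) l / sqrt (1 + l k * C k k)"
proof -
  interpret product_sigma_finite "\<lambda>_. std_normal_distribution"
    by (rule product_sigma_finite_std_normal)
  define d where "d = 1 + l k * C k k"
  define m where "m = (\<lambda>x. \<Sum>i\<in>I. C k i * (sqrt (l i) * x i))"
  have ckk: "0 \<le> C k k" using psd_on_diag[OF psd] fin by simp
  have sym: "\<And>i. i \<in> I \<Longrightarrow> C i k = C k i" using psd_on_sym[OF psd] by blast
  have qins: "qform (insert k I) C v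
      = C k k * (v k)\<^sup>2 + 2 * v k * (\<Sum>i\<in>I. C k i * v i) + qform I C v" for v
    by (rule qform_insert[OF fin]) (rule sym)
  have q: "qform (insert k I) C (\<lambda>i. sqrt (l i) * (x(k := y)) i)
      = l k * C k k * y\<^sup>2 + 2 * (sqrt (l k) * m x) * y + qform I C (\<lambda>i. sqrt (l i) * x i)" for x y
  proof -
    have "(\<Sum>i\<in>I. C k i * (sqrt (l i) * (x(k := y)) i)) = m x"
      unfolding m_def using fin by (intro sum.cong) auto
    moreover have "qform I C (\<lambda>i. sqrt (l i) * (x(k := y)) i) = qform I C (\<lambda>i. sqrt (l i) * x i)"
      using fin by (intro qform_cong) auto
    moreover have "(x(k := y)) k = y" by simp
    ultimately show ?thesis using l
      by (simp only: qins power_mult_distrib real_sqrt_pow2) (simp only: mult_ac)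
  qed
  have "gauss_lap (insert k I) C l
      = (\<integral>x. (\<integral>y. exp (- qform (insert k I) C (\<lambda>i. sqrt (l i) * (x(k := y)) i) / 2)
          \<partial>std_normal_distribution) \<partial>std_gauss I)"
    unfolding gauss_lap_def
    by (rule product_integral_insert[OF fin integrable_gauss_lap[OF psd]])
  also have "\<dots> = (\<integral>x. exp (- qform I (schur l k C) (\<lambda>i. sqrt (l i) * x i) / 2) / sqrt d \<partial>std_gauss I)"
    unfolding q
  proof (rule Bochner_Integration.integral_cong[OF refl])
    fix x
    have "0 \<le> l k * C k k" using l ckk by simp
    from integral_std_normal_exp_quadratic[OF this, of "sqrt (l k) * m x"]
    show "(\<integral>y. exp (- (l k * C k k * y\<^sup>2 + 2 * (sqrt (l k) * m x) * y
          + qform I C (\<lambda>i. sqrt (l i) * x i)) / 2) \<partial>std_normal_distribution)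
        = exp (- qform I (schur l k C) (\<lambda>i. sqrt (l i) * x i) / 2) / sqrt d"
      using l unfolding qform_schur d_def m_def by (simp add: power_mult_distrib)
  qed
  also have "\<dots> = gauss_lap I (schur l k C) l / sqrt d"
    unfolding gauss_lap_def by simp
  finally show ?thesis unfolding d_def .
qed

section \<open>Determinants as Gaussian integrals\<close>

text \<open>
For positive semidefinite \<open>C\<close> and \<open>l \<ge> 0\<close> this is the determinant of \<open>1 + diag(l) C\<close>.
Taking the Gaussian integral as its definition leaves only the elimination rule \<open>gauss_det_insert\<close> to be proved, for arbitrary finite index sets.
\<close>
definition gauss_det :: "'i set \<Rightarrow> ('i \<Rightarrow> 'i \<Rightarrow> real) \<Rightarrow> ('i \<Rightarrow> real) \<Rightarrow> real" where
  "gauss_det I C l = 1 / (gauss_lap I C l)\<^sup>2"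

lemma gauss_det_pos: "psd_on I C \<Longrightarrow> 0 < gauss_det I C l"
  unfolding gauss_det_def using gauss_lap_pos[of I C l] by simp

lemma gauss_lap_eq_gauss_det: "psd_on I C \<Longrightarrow> gauss_lap I C l = 1 / sqrt (gauss_det I C l)"
  unfolding gauss_det_def using gauss_lap_pos[of I C l] by (simp add: real_sqrt_divide)

lemma gauss_det_empty: "gauss_det {} C l = 1"
  unfolding gauss_det_def by (simp add: gauss_lap_empty)

lemma gauss_det_cong:
  assumes "\<And>i j. i \<in> I \<Longrightarrow> j \<in> I \<Longrightarrow> C i j = C' i j" "\<And>i. i \<in> I \<Longrightarrow> l i = l' i"
  shows "gauss_det I C l = gauss_det I C' l'"
  unfolding gauss_det_def using gauss_lap_cong[of I C C' l l'] assms by simp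

lemma gauss_det_insert:
  assumes psd: "psd_on (insert k I) C" and fin: "finite I" "k \<notin> I" and l: "0 \<le> l k"
  shows "gauss_det (insert k I) C l = (1 + l k * C k k) * gauss_det I (schur l k C) l"
proof -
  have "0 \<le> C k k" using psd_on_diag[OF psd] fin by simp
  then show ?thesis
    unfolding gauss_det_def gauss_lap_insert[where l = l, OF assms]
    using l by (simp add: power_divide)
qed

text \<open>
Eliminating the coordinates other than \<open>k\<close> leaves a factor \<open>1 + l k * C' k k\<close> in which \<open>C'\<close> does
not depend on \<open>l k\<close>. The interpolation form with the values at 0 and 1 is stable under taking
derivatives in a parameter.
\<close>
lemma gauss_det_affine:
  assumes "finite I" "k \<notin> I" "psd_on (insert k I) C" "\<And>i. 0 \<le> l i" "0 \<le> x"
  shows "gauss_det (insert k I) C (l(k := x))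
    = (1 - x) * gauss_det (insert k I) C (l(k := 0)) + x * gauss_det (insert k I) C (l(k := 1))"
  using assms(1-3)
proof (induction I arbitrary: C)
  case empty
  have "gauss_det {k} C (l(k := z)) = 1 + z * C k k" if "0 \<le> z" for z
    using gauss_det_insert[of k "{}" C "l(k := z)"] that empty by (simp add: gauss_det_empty)
  then show ?case
    using assms(5) by (simp only: order_refl zero_le_one) (simp add: algebra_simps)
next
  case (insert j I)
  have kj: "k \<noteq> j" using insert.prems by simp
  have ins: "insert k (insert j I) = insert j (insert k I)" by blast
  have psd: "psd_on (insert j (insert k I)) C" using insert.prems ins by simp
  have psd': "psd_on (insert k I) (schur l j C)"
    using psd_on_schur[OF psd] insert.hyps kj assms(4) by simp
  have elim: "gauss_det (insert k (insert j I)) C (l(k := z))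
      = (1 + l j * C j j) * gauss_det (insert k I) (schur l j C) (l(k := z))" if "0 \<le> z" for z
  proof -
    have "schur (l(k := z)) j C = schur l j C"
      unfolding schur_def using kj by (intro ext) simp
    then show ?thesis
      unfolding ins using gauss_det_insert[OF psd, of "l(k := z)"] insert.hyps kj assms(4) by simp
  qed
  have IH: "gauss_det (insert k I) (schur l j C) (l(k := x))
    = (1 - x) * gauss_det (insert k I) (schur l j C) (l(k := 0))
      + x * gauss_det (insert k I) (schur l j C) (l(k := 1))"
    using insert.prems by (intro insert.IH psd') auto
  show ?case
    by (simp only: elim[OF assms(5)] elim[OF order_refl] elim[OF zero_le_one] IH) (simp only: algebra_simps)
qed

text \<open>
Elimination exhibits \<open>gauss_det\<close> as a rational function of the entries without poles on positive
semidefinite matrices.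
\<close>
lemma gauss_det_differentiable_on:
  fixes T :: "real set"
  assumes "finite I" "\<And>\<tau>. \<tau> \<in> T \<Longrightarrow> psd_on I (C \<tau>)" "\<And>i. 0 \<le> l i"
    and "\<And>i j. i \<in> I \<Longrightarrow> j \<in> I \<Longrightarrow> (\<lambda>\<tau>. C \<tau> i j) differentiable_on T"
  shows "(\<lambda>\<tau>. gauss_det I (C \<tau>) l) differentiable_on T"
  using assms(1,2,4)
proof (induction I arbitrary: C)
  case empty
  then show ?case by (simp add: gauss_det_empty)
next
  case (insert k I)
  have nz: "1 + l k * C \<tau> k k \<noteq> 0" if "\<tau> \<in> T" for \<tau>
    using psd_on_diag[OF insert.prems(1)[OF that], of k] insert.hyps assms(3)[of k]
    by (smt (verit) finite_insert insertI1 mult_nonneg_nonneg)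
  have dk: "(\<lambda>\<tau>. 1 + l k * C \<tau> k k) differentiable_on T"
    using insert.prems(2)[of k k] by (auto intro!: derivative_intros)
  have "(\<lambda>\<tau>. gauss_det I (schur l k (C \<tau>)) l) differentiable_on T"
  proof (rule insert.IH)
    show "psd_on I (schur l k (C \<tau>))" if "\<tau> \<in> T" for \<tau>
      using psd_on_schur[OF insert.prems(1)[OF that] insert.hyps] assms(3) by simp
    fix i j assume ij: "i \<in> I" "j \<in> I"
    then show "(\<lambda>\<tau>. schur l k (C \<tau>) i j) differentiable_on T"
      unfolding schur_def differentiable_on_def
      using insert.prems(2)[unfolded differentiable_on_def] nz dk[unfolded differentiable_on_def]
      by (intro ballI differentiable_diff differentiable_divide differentiable_mult differentiable_const)
        auto
  qed
  then have "(\<lambda>\<tau>. (1 + l k * C \<tau> k k) * gauss_det I (schur l k (C \<tau>)) l) differentiable_on T"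
    by (rule differentiable_on_mult[OF dk])
  moreover have eq: "(1 + l k * C \<tau> k k) * gauss_det I (schur l k (C \<tau>)) l = gauss_det (insert k I) (C \<tau>) l"
    if "\<tau> \<in> T" for \<tau>
    using gauss_det_insert[where l = l, OF insert.prems(1)[OF that] insert.hyps assms(3)] by simp
  ultimately show ?case
    unfolding differentiable_on_def
  proof (intro ballI)
    fix t assume t: "t \<in> T"
    assume "\<forall>t\<in>T. (\<lambda>\<tau>. (1 + l k * C \<tau> k k) * gauss_det I (schur l k (C \<tau>)) l)
      differentiable at t within T"
    then have "(\<lambda>\<tau>. (1 + l k * C \<tau> k k) * gauss_det I (schur l k (C \<tau>)) l)
      differentiable at t within T" using t ..
    then show "(\<lambda>\<tau>. gauss_det (insert k I) (C \<tau>) l) differentiable at t within T"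
      by (rule differentiable_transform_within[OF _ zero_less_one t]) (rule eq)
  qed
qed

text \<open>
Changing the signs of some coordinates does not change the law of the squares; elimination
commutes with such a change.
\<close>
lemma gauss_lap_sign_change:
  assumes "finite I" "psd_on I C" "\<And>i. 0 \<le> l i" and e: "\<And>i. e i * e i = (1::real)"
  shows "gauss_lap I (\<lambda>i j. e i * e j * C i j) l = gauss_lap I C l"
  using assms(1,2)
proof (induction I arbitrary: C)
  case empty
  then show ?case by (simp add: gauss_lap_empty)
next
  case (insert k I)
  let ?D = "\<lambda>i j. e i * e j * C i j"
  have psdD: "psd_on (insert k I) ?D"
    unfolding psd_on_def
  proof (intro conjI allI ballI)
    show "?D i j = ?D j i" if "i \<in> insert k I" "j \<in> insert k I" for i j
      unfolding psd_on_sym[OF insert.prems that] by (simp only: mult.commute[of "e i"])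
    fix v
    have "qform (insert k I) ?D v = qform (insert k I) C (\<lambda>i. e i * v i)"
      unfolding qform_def by (simp add: mult_ac)
    then show "0 \<le> qform (insert k I) ?D v"
      using psd_on_nonneg[OF insert.prems] by simp
  qed
  have "schur l k ?D = (\<lambda>i j. e i * e j * schur l k C i j)"
  proof (intro ext)
    fix i j
    have "l k * (e k * e i * C k i) * (e k * e j * C k j) / (1 + l k * (e k * e k * C k k))
        = (e k * e k) * (e i * e j * (l k * C k i * C k j / (1 + l k * ((e k * e k) * C k k))))"
      by (simp add: mult_ac)
    then show "schur l k ?D i j = e i * e j * schur l k C i j"
      unfolding schur_def e by (simp add: algebra_simps)
  qed
  moreover have "gauss_lap I (\<lambda>i j. e i * e j * schur l k C i j) l = gauss_lap I (schur l k C) l"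
    using insert assms(3) by (intro insert.IH psd_on_schur) auto
  ultimately show ?case
    using gauss_lap_insert[OF psdD insert.hyps, of l] gauss_lap_insert[OF insert.prems insert.hyps, of l]
    by (simp add: e assms(3))
qed

definition interp_cov :: "'i set \<Rightarrow> ('i \<Rightarrow> 'i \<Rightarrow> real) \<Rightarrow> real \<Rightarrow> 'i \<Rightarrow> 'i \<Rightarrow> real" where
  "interp_cov A C \<tau> i j = (if i \<in> A \<longleftrightarrow> j \<in> A then C i j else \<tau> * C i j)"

lemma interp_cov_1: "interp_cov A C 1 = C"
  unfolding interp_cov_def by (intro ext) simp

lemma interp_cov_uminus: "interp_cov A C (- \<tau>)
    = (\<lambda>i j. (if i \<in> A then 1 else - 1) * (if j \<in> A then 1 else - 1) * interp_cov A C \<tau> i j)"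
  unfolding interp_cov_def by (intro ext) auto

lemma qform_interp_cov:
  "qform I (interp_cov A C \<tau>) v = qform I (interp_cov A C 0) v + \<tau> * qform I (\<lambda>i j. interp_cov A C 1 i j - interp_cov A C 0 i j) v"
  unfolding qform_def sum_distrib_left sum.distrib[symmetric]
  by (intro sum.cong refl) (simp add: interp_cov_def algebra_simps)

lemma psd_on_interp_cov:
  assumes psd: "psd_on I C" and \<tau>: "\<bar>\<tau>\<bar> \<le> 1"
  shows "psd_on I (interp_cov A C \<tau>)"
  unfolding psd_on_def
proof (intro conjI allI ballI)
  show "interp_cov A C \<tau> i j = interp_cov A C \<tau> j i" if "i \<in> I" "j \<in> I" for i j
    unfolding interp_cov_def psd_on_sym[OF psd that] by auto
  fix v
  have "0 \<le> qform I (interp_cov A C 1) v"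
    using psd unfolding interp_cov_1 psd_on_def by blast
  moreover have "0 \<le> qform I (interp_cov A C (- 1)) v"
  proof -
    have "qform I (interp_cov A C (- 1)) v = qform I C (\<lambda>i. (if i \<in> A then 1 else - 1) * v i)"
      unfolding interp_cov_uminus interp_cov_1 qform_def by (intro sum.cong refl) auto
    then show ?thesis using psd unfolding psd_on_def by metis
  qed
  ultimately have "0 \<le> (1 + \<tau>) / 2 * qform I (interp_cov A C 1) v + (1 - \<tau>) / 2 * qform I (interp_cov A C (- 1)) v"
    using \<tau> by (intro add_nonneg_nonneg mult_nonneg_nonneg) auto
  also have "\<dots> = qform I (interp_cov A C \<tau>) v"
    unfolding qform_interp_cov[of I A C 1] qform_interp_cov[of I A C "- 1"] qform_interp_cov[of I A C \<tau>]
    by (simp add: field_simps)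
  finally show "0 \<le> qform I (interp_cov A C \<tau>) v" .
qed

text \<open>
Since the function is even in the parameter, averaging the integrand over both signs replaces an
exponential by \<open>cosh\<close>, and then the integrand is monotone pointwise.
\<close>
lemma gauss_lap_interp_mono:
  assumes "finite I" and psd: "psd_on I C" and l: "\<And>i. 0 \<le> l i" and st: "0 \<le> \<sigma>" "\<sigma> \<le> \<tau>" "\<tau> \<le> 1"
  shows "gauss_lap I (interp_cov A C \<sigma>) l \<le> gauss_lap I (interp_cov A C \<tau>) l"
proof -
  define B where "B = (\<lambda>y. qform I (\<lambda>i j. interp_cov A C 1 i j - interp_cov A C 0 i j) (\<lambda>i. sqrt (l i) * y i))"
  define Q where "Q = (\<lambda>y. qform I (interp_cov A C 0) (\<lambda>i. sqrt (l i) * y i))"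
  have int: "integrable (std_gauss I) (\<lambda>y. exp (- (Q y + r * B y) / 2))"
    and eq: "gauss_lap I (interp_cov A C r) l = (\<integral>y. exp (- (Q y + r * B y) / 2) \<partial>std_gauss I)"
    if "\<bar>r\<bar> \<le> 1" for r
    using integrable_gauss_lap[OF psd_on_interp_cov[OF psd that], of A "\<lambda>i. sqrt (l i)"]
    unfolding B_def Q_def gauss_lap_def qform_interp_cov[of I A C r] by simp_all
  have int': "integrable (std_gauss I) (\<lambda>y. exp (- Q y / 2) * cosh (r * B y / 2))"
    and eq': "gauss_lap I (interp_cov A C r) l = (\<integral>y. exp (- Q y / 2) * cosh (r * B y / 2) \<partial>std_gauss I)"
    if r: "\<bar>r\<bar> \<le> 1" for r
  proof -
    have half: "exp (- Q y / 2) * cosh (r * B y / 2)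
        = (exp (- (Q y + r * B y) / 2) + exp (- (Q y + (- r) * B y) / 2)) / 2" for y
      by (simp add: cosh_def exp_add[symmetric] exp_diff exp_minus field_simps)
    have r': "\<bar>- r\<bar> \<le> 1" using r by simp
    show "integrable (std_gauss I) (\<lambda>y. exp (- Q y / 2) * cosh (r * B y / 2))"
      unfolding half using int[OF r] int[OF r'] by simp
    have "gauss_lap I (interp_cov A C (- r)) l = gauss_lap I (interp_cov A C r) l"
      unfolding interp_cov_uminus
      by (rule gauss_lap_sign_change[OF assms(1) psd_on_interp_cov[OF psd r] l]) auto
    then have "gauss_lap I (interp_cov A C r) l
        = ((\<integral>y. exp (- (Q y + r * B y) / 2) \<partial>std_gauss I)
          + (\<integral>y. exp (- (Q y + (- r) * B y) / 2) \<partial>std_gauss I)) / 2"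
      using eq[OF r] eq[OF r'] by simp
    also have "\<dots> = (\<integral>y. exp (- Q y / 2) * cosh (r * B y / 2) \<partial>std_gauss I)"
      unfolding half using int[OF r] int[OF r'] by simp
    finally show "gauss_lap I (interp_cov A C r) l
        = (\<integral>y. exp (- Q y / 2) * cosh (r * B y / 2) \<partial>std_gauss I)" .
  qed
  have mono: "cosh (\<sigma> * b / 2) \<le> cosh (\<tau> * b / 2)" for b :: real
  proof -
    have "\<bar>\<sigma> * b / 2\<bar> \<le> \<bar>\<tau> * b / 2\<bar>"
      using st by (simp add: abs_mult mult_right_mono)
    then have "cosh \<bar>\<sigma> * b / 2\<bar> \<le> cosh \<bar>\<tau> * b / 2\<bar>"
      by (subst cosh_real_nonneg_le_iff) auto
    then show ?thesis by (simp only: cosh_real_abs)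
  qed
  have st': "\<bar>\<sigma>\<bar> \<le> 1" "\<bar>\<tau>\<bar> \<le> 1" using st by auto
  show ?thesis
    unfolding eq'[OF st'(1)] eq'[OF st'(2)]
    by (intro integral_mono int' st' mult_left_mono mono) simp
qed

section \<open>Characteristic functions of Gaussian vectors\<close>

text \<open>
Gaussian laws enter the differentiation argument only through their characteristic functions,
which for the coupled vectors \<open>interp_vec\<close> are products of two characteristic functions of \<open>X\<close>.
\<close>
definition has_gauss_char ::
  "'a measure \<Rightarrow> 'i set \<Rightarrow> ('i \<Rightarrow> 'a \<Rightarrow> real) \<Rightarrow> ('i \<Rightarrow> 'i \<Rightarrow> real) \<Rightarrow> bool" where
  "has_gauss_char M I X C \<longleftrightarrow> (\<forall>i\<in>I. X i \<in> borel_measurable M) \<and>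
     (\<forall>a. (CLINT \<omega>|M. iexp (\<Sum>i\<in>I. a i * X i \<omega>)) = of_real (exp (- qform I C a / 2)))"

lemma has_gauss_charD:
  assumes "has_gauss_char M I X C"
  shows "i \<in> I \<Longrightarrow> X i \<in> borel_measurable M"
    and "(CLINT \<omega>|M. iexp (\<Sum>i\<in>I. a i * X i \<omega>)) = of_real (exp (- qform I C a / 2))"
  using assms unfolding has_gauss_char_def by blast+

lemma integrable_iexp_real:
  assumes "prob_space M" "f \<in> borel_measurable M"
  shows "integrable M (\<lambda>x. iexp (f x))"
proof -
  interpret prob_space M by fact
  show ?thesis using assms(2) by (intro integrable_const_bound[where B = 1]) auto
qed

lemma measurable_lincomb:
  fixes a :: "'i \<Rightarrow> real"
  assumes "\<And>i. i \<in> I \<Longrightarrow> X i \<in> borel_measurable M" 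
  shows "(\<lambda>\<omega>. \<Sum>i\<in>I. a i * X i \<omega>) \<in> borel_measurable M"
  using assms by (intro borel_measurable_sum borel_measurable_times) auto

text \<open>
Write \<open>exp(- l x\<^sup>2 / 2)\<close> as the characteristic function of a standard normal variable at
\<open>sqrt l * x\<close>, exchange the two integrations, and use the characteristic function of \<open>X\<close>.
\<close>
lemma integral_exp_neg_squares:
  assumes P: "prob_space M" and fin: "finite I" and X: "has_gauss_char M I X C" and l: "\<And>i. 0 \<le> l i"
  shows "(\<integral>\<omega>. exp (- (\<Sum>i\<in>I. l i * (X i \<omega>)\<^sup>2) / 2) \<partial>M) = gauss_lap I C l"
proof -
  let ?s = "\<lambda>i. sqrt (l i)"
  interpret product_sigma_finite "\<lambda>_. std_normal_distribution"
    by (rule product_sigma_finite_std_normal)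
  interpret G: prob_space "std_gauss I" by (rule prob_space_std_gauss)
  interpret M: prob_space M by fact
  interpret pair_prob_space M "std_gauss I" ..
  note meas = has_gauss_charD(1)[OF X]
  have inner: "of_real (exp (- (\<Sum>i\<in>I. l i * (X i \<omega>)\<^sup>2) / 2))
      = (CLINT y|std_gauss I. iexp (\<Sum>i\<in>I. ?s i * y i * X i \<omega>))" for \<omega>
  proof -
    have "complex_of_real (exp (- (\<Sum>i\<in>I. l i * (X i \<omega>)\<^sup>2) / 2))
        = (\<Prod>i\<in>I. of_real (exp (- ((?s i * X i \<omega>)\<^sup>2) / 2)))"
      using fin l by (simp only: power_mult_distrib real_sqrt_pow2 exp_sum of_real_prod[symmetric]
          sum_negf[symmetric] sum_divide_distrib)
    also have "\<dots> = (\<Prod>i\<in>I. CLINT y|std_normal_distribution. iexp (?s i * X i \<omega> * y))"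
      unfolding fun_cong[OF char_std_normal_distribution, unfolded char_def] ..
    also have "\<dots> = (CLINT y|std_gauss I. (\<Prod>i\<in>I. iexp (?s i * X i \<omega> * y i)))"
      by (rule product_integral_prod[OF fin, symmetric]) (rule integrable_iexp_real[OF prob_space_std_normal], simp)
    also have "\<dots> = (CLINT y|std_gauss I. iexp (\<Sum>i\<in>I. ?s i * y i * X i \<omega>))"
      using fin by (simp add: exp_sum sum_distrib_left mult_ac)
    finally show ?thesis .
  qed
  have "complex_of_real (\<integral>\<omega>. exp (- (\<Sum>i\<in>I. l i * (X i \<omega>)\<^sup>2) / 2) \<partial>M)
      = (CLINT \<omega>|M. CLINT y|std_gauss I. iexp (\<Sum>i\<in>I. ?s i * y i * X i \<omega>))"
    unfolding inner[symmetric] by (rule integral_complex_of_real[symmetric])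
  also have "\<dots> = (CLINT y|std_gauss I. CLINT \<omega>|M. iexp (\<Sum>i\<in>I. ?s i * y i * X i \<omega>))"
  proof (rule Fubini_integral[symmetric])
    have "(\<lambda>p. \<Sum>i\<in>I. ?s i * snd p i * X i (fst p)) \<in> borel_measurable (M \<Otimes>\<^sub>M std_gauss I)"
      by (intro borel_measurable_sum borel_measurable_times borel_measurable_const
          measurable_compose[OF measurable_fst meas]
          measurable_compose[OF measurable_snd measurable_std_gauss_component])
    from integrable_iexp_real[OF _ this]
    show "integrable (M \<Otimes>\<^sub>M std_gauss I) (\<lambda>(\<omega>, y). iexp (\<Sum>i\<in>I. ?s i * y i * X i \<omega>))"
      by (simp add: case_prod_beta' P.prob_space_axioms)
  qed
  also have "\<dots> = of_real (gauss_lap I C l)"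
    unfolding has_gauss_charD(2)[OF X] gauss_lap_def by (rule integral_complex_of_real)
  finally show ?thesis by (simp only: of_real_eq_iff)
qed

text \<open>
A vector with covariance \<open>interp_cov A C \<tau>\<close>, built from two independent copies of \<open>X\<close>. The weights
\<open>\<tau>\<close> and \<open>sqrt (1 - \<tau>\<^sup>2)\<close> keep the law of the block outside \<open>A\<close>, and only the first copy is
correlated with the block \<open>A\<close>.
\<close>
definition interp_vec ::
  "'i set \<Rightarrow> ('i \<Rightarrow> 'a \<Rightarrow> real) \<Rightarrow> real \<Rightarrow> 'i \<Rightarrow> 'a \<times> 'a \<Rightarrow> real" where
  "interp_vec A X \<tau> i = (\<lambda>(\<omega>, \<omega>'). if i \<in> A then X i \<omega> else \<tau> * X i \<omega> + sqrt (1 - \<tau>\<^sup>2) * X i \<omega>')"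

lemma measurable_interp_vec:
  assumes "X i \<in> borel_measurable M"
  shows "interp_vec A X \<tau> i \<in> borel_measurable (M \<Otimes>\<^sub>M M)"
  using assms unfolding interp_vec_def by measurable

lemma has_gauss_char_interp_vec:
  assumes P: "prob_space M" and fin: "finite I" and X: "has_gauss_char M I X C" and \<tau>: "\<bar>\<tau>\<bar> \<le> 1"
  shows "has_gauss_char (M \<Otimes>\<^sub>M M) I (interp_vec A X \<tau>) (interp_cov A C \<tau>)"
  unfolding has_gauss_char_def
proof (intro conjI ballI allI)
  interpret M: prob_space M by fact
  interpret pair_prob_space M M ..
  note meas = has_gauss_charD(1)[OF X]
  show "interp_vec A X \<tau> i \<in> borel_measurable (M \<Otimes>\<^sub>M M)" if "i \<in> I" for i
    by (rule measurable_interp_vec) (rule meas[OF that])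
  fix a :: "'b \<Rightarrow> real"
  define b c where "b = (\<lambda>i. if i \<in> A then a i else \<tau> * a i)"
    and "c = (\<lambda>i. if i \<in> A then 0 else sqrt (1 - \<tau>\<^sup>2) * a i)"
  have split: "(\<Sum>i\<in>I. a i * interp_vec A X \<tau> i (\<omega>, \<omega>'))
      = (\<Sum>i\<in>I. b i * X i \<omega>) + (\<Sum>i\<in>I. c i * X i \<omega>')" for \<omega> \<omega>'
    unfolding sum.distrib[symmetric] interp_vec_def b_def c_def
    by (intro sum.cong) (auto simp: algebra_simps)
  have q: "qform I C b + qform I C c = qform I (interp_cov A C \<tau>) a"
  proof -
    have sq: "sqrt (1 - \<tau>\<^sup>2) * sqrt (1 - \<tau>\<^sup>2) = 1 - \<tau> * \<tau>"
      using \<tau> by (simp add: power2_eq_square abs_square_le_1[symmetric, unfolded power2_eq_square])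
    have "C i j * b i * b j + C i j * c i * c j = interp_cov A C \<tau> i j * a i * a j" for i j
    proof -
      have "\<tau> * (\<tau> * z) + sqrt (1 - \<tau>\<^sup>2) * (sqrt (1 - \<tau>\<^sup>2) * z) = z" for z
        using sq by (simp add: mult.assoc[symmetric] distrib_right[symmetric])
      from this[of "C i j * a i * a j"] show ?thesis
        unfolding b_def c_def interp_cov_def by (simp add: mult_ac)
    qed
    then show ?thesis
      unfolding qform_def sum.distrib[symmetric] by simp
  qed
  have "(CLINT p|M \<Otimes>\<^sub>M M. iexp (\<Sum>i\<in>I. a i * interp_vec A X \<tau> i p))
      = (CLINT \<omega>|M. CLINT \<omega>'|M. iexp (\<Sum>i\<in>I. a i * interp_vec A X \<tau> i (\<omega>, \<omega>')))"
    by (rule integral_fst'[symmetric], rule integrable_iexp_real[OF P.prob_space_axioms])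
      (intro measurable_lincomb measurable_interp_vec meas)
  also have "\<dots> = (CLINT \<omega>|M. CLINT \<omega>'|M. iexp (\<Sum>i\<in>I. b i * X i \<omega>) * iexp (\<Sum>i\<in>I. c i * X i \<omega>'))"
    unfolding split of_real_add distrib_left exp_add ..
  also have "\<dots> = of_real (exp (- qform I C b / 2)) * of_real (exp (- qform I C c / 2))"
    by (simp only: integral_mult_right_zero integral_mult_left_zero has_gauss_charD(2)[OF X])
  also have "\<dots> = of_real (exp (- qform I (interp_cov A C \<tau>) a / 2))"
    unfolding q[symmetric] of_real_mult[symmetric] exp_add[symmetric] by (simp add: add_divide_distrib)
  finally show "(CLINT p|M \<Otimes>\<^sub>M M. iexp (\<Sum>i\<in>I. a i * interp_vec A X \<tau> i p))
      = of_real (exp (- qform I (interp_cov A C \<tau>) a / 2))" .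
qed

lemma centered_normal_char:
  assumes P: "prob_space M" and Y: "centered_normal_rv M Y"
  shows "integrable M (\<lambda>\<omega>. (Y \<omega>)\<^sup>2)"
    and "(CLINT \<omega>|M. iexp (Y \<omega>)) = of_real (exp (- (\<integral>\<omega>. (Y \<omega>)\<^sup>2 \<partial>M) / 2))"
proof -
  interpret prob_space M by fact
  have Ym[measurable]: "Y \<in> borel_measurable M" using Y unfolding centered_normal_rv_def by blast
  have "integrable M (\<lambda>\<omega>. (Y \<omega>)\<^sup>2) \<and>
    (CLINT \<omega>|M. iexp (Y \<omega>)) = of_real (exp (- (\<integral>\<omega>. (Y \<omega>)\<^sup>2 \<partial>M) / 2))"
  proof (cases "AE \<omega> in M. Y \<omega> = 0")
    case True
    have "integrable M (\<lambda>\<omega>. (Y \<omega>)\<^sup>2) \<longleftrightarrow> integrable M (\<lambda>\<omega>. 0::real)"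
      using True by (intro integrable_cong_AE) auto
    moreover have "(\<integral>\<omega>. (Y \<omega>)\<^sup>2 \<partial>M) = (\<integral>\<omega>. 0 \<partial>M)"
      using True by (intro integral_cong_AE) auto
    moreover have "(CLINT \<omega>|M. iexp (Y \<omega>)) = (CLINT \<omega>|M. 1)"
      using True by (intro integral_cong_AE) auto
    ultimately show ?thesis by (simp add: prob_space)
  next
    case False
    then obtain s where s: "s > 0" and D: "distributed M lborel Y (normal_density 0 s)"
      using Y unfolding centered_normal_rv_def by blast
    have "integrable M (\<lambda>\<omega>. (Y \<omega>)\<^sup>2)"
      using distributed_integrable[OF D, of "\<lambda>x. x\<^sup>2"] integrable_normal_moment[OF s, of 0 2] by simp
    moreover have "(\<integral>\<omega>. (Y \<omega>)\<^sup>2 \<partial>M) = s\<^sup>2"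
      using normal_distributed_variance[OF s D] normal_distributed_expectation[OF s D] by simp
    moreover have "(CLINT \<omega>|M. iexp (Y \<omega>)) = of_real (exp (- s\<^sup>2 / 2))"
    proof -
      have D1: "distributed M lborel (\<lambda>\<omega>. Y \<omega> / s) std_normal_density"
        using D normal_standard_normal_convert[OF s, of Y 0] by simp
      have "(CLINT \<omega>|M. iexp (Y \<omega>)) = (CLINT \<omega>|M. iexp (s * (Y \<omega> / s)))"
        using s by simp
      also have "\<dots> = (CLINT x|distr M lborel (\<lambda>\<omega>. Y \<omega> / s). iexp (s * x))"
        by (rule integral_distr[symmetric]) auto
      also have "\<dots> = char std_normal_distribution s"
        unfolding distributed_distr_eq_density[OF D1] char_def ..
      finally show ?thesis unfolding char_std_normal_distribution .
    qed
    ultimately show ?thesis by simp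
  qed
  then show "integrable M (\<lambda>\<omega>. (Y \<omega>)\<^sup>2)"
    and "(CLINT \<omega>|M. iexp (Y \<omega>)) = of_real (exp (- (\<integral>\<omega>. (Y \<omega>)\<^sup>2 \<partial>M) / 2))" by blast+
qed

lemma centered_gaussian_vector_char:
  assumes P: "prob_space M" and X: "centered_gaussian_vector M I X"
  shows "\<exists>C. psd_on I C \<and> has_gauss_char M I X C"
proof (intro exI conjI)
  interpret prob_space M by fact
  let ?C = "\<lambda>i j. \<integral>\<omega>. X i \<omega> * X j \<omega> \<partial>M"
  have fin: "finite I" and meas: "\<And>i. i \<in> I \<Longrightarrow> X i \<in> borel_measurable M"
    and lin: "\<And>a. centered_normal_rv M (\<lambda>\<omega>. \<Sum>i\<in>I. a i * X i \<omega>)"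
    using X unfolding centered_gaussian_vector_def by blast+
  have sq: "integrable M (\<lambda>\<omega>. (X i \<omega>)\<^sup>2)" if "i \<in> I" for i
  proof -
    have eq: "(\<Sum>j\<in>I. (if j = i then 1 else 0) * X j \<omega>) = X i \<omega>" for \<omega>
      using fin that by (simp add: if_distrib[of "\<lambda>x. x * _"] cong: if_cong)
    show ?thesis
      using centered_normal_char(1)[OF P lin[of "\<lambda>j. if j = i then 1 else 0"]] unfolding eq .
  qed
  have prod: "integrable M (\<lambda>\<omega>. X i \<omega> * X j \<omega>)" if "i \<in> I" "j \<in> I" for i j
  proof (rule Bochner_Integration.integrable_bound)
    show "integrable M (\<lambda>\<omega>. (X i \<omega>)\<^sup>2 + (X j \<omega>)\<^sup>2)" using sq that by auto
    show "(\<lambda>\<omega>. X i \<omega> * X j \<omega>) \<in> borel_measurable M" using meas that by auto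
    have "\<bar>x * y\<bar> \<le> x\<^sup>2 + y\<^sup>2" for x y :: real
    proof -
      have "2 * (\<bar>x\<bar> * \<bar>y\<bar>) \<le> x\<^sup>2 + y\<^sup>2"
        using sum_squares_bound[of "\<bar>x\<bar>" "\<bar>y\<bar>"] by (simp add: mult.assoc)
      moreover have "0 \<le> \<bar>x\<bar> * \<bar>y\<bar>" by simp
      ultimately show ?thesis unfolding abs_mult by linarith
    qed
    then show "AE \<omega> in M. norm (X i \<omega> * X j \<omega>) \<le> norm ((X i \<omega>)\<^sup>2 + (X j \<omega>)\<^sup>2)"
      by (intro AE_I2) (smt (verit) real_norm_def)
  qed
  have var: "(\<integral>\<omega>. (\<Sum>i\<in>I. a i * X i \<omega>)\<^sup>2 \<partial>M) = qform I ?C a" for a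
  proof -
    have "(\<integral>\<omega>. (\<Sum>i\<in>I. a i * X i \<omega>)\<^sup>2 \<partial>M)
        = (\<integral>\<omega>. (\<Sum>i\<in>I. \<Sum>j\<in>I. (X i \<omega> * X j \<omega>) * (a i * a j)) \<partial>M)"
      unfolding power2_eq_square sum_product by (simp add: mult_ac)
    also have "\<dots> = (\<Sum>i\<in>I. \<Sum>j\<in>I. ?C i j * (a i * a j))"
      using prod by (simp add: Bochner_Integration.integral_sum)
    finally show ?thesis unfolding qform_def by (simp add: mult.assoc)
  qed
  show "psd_on I ?C"
    unfolding psd_on_def var[symmetric] by (simp add: mult.commute)
  show "has_gauss_char M I X ?C"
    unfolding has_gauss_char_def
    using meas centered_normal_char(2)[OF P lin] var by simp
qed

section \<open>Positivity of weighted moment sums\<close>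

text \<open>
Splitting off one coordinate writes \<open>f\<close> as \<open>g + l k * h\<close>. Both \<open>g\<close> and \<open>h\<close> are nonnegative:
\<open>g\<close> as the value at \<open>l k = 0\<close>, and \<open>h\<close> because \<open>l k\<close> can be arbitrarily large.
\<close>
lemma nonneg_multiaffine_expansion:
  fixes f :: "('i \<Rightarrow> real) \<Rightarrow> real"
  assumes "finite I"
    and "\<And>l. (\<And>i. 0 \<le> l i) \<Longrightarrow> 0 \<le> f l"
    and "\<And>l l'. (\<And>i. i \<in> I \<Longrightarrow> l i = l' i) \<Longrightarrow> f l = f l'"
    and "\<And>l k x. (\<And>i. 0 \<le> l i) \<Longrightarrow> k \<in> I \<Longrightarrow> 0 \<le> x \<Longrightarrow>
      f (l(k := x)) = (1 - x) * f (l(k := 0)) + x * f (l(k := 1))"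
  shows "\<exists>a. (\<forall>J. 0 \<le> a J) \<and> (\<forall>l. (\<forall>i. 0 \<le> l i) \<longrightarrow> f l = (\<Sum>J\<in>Pow I. a J * (\<Prod>i\<in>J. l i)))"
  using assms
proof (induction I arbitrary: f)
  case empty
  have "f l = f (\<lambda>_. 0)" for l by (rule empty.prems(2)) simp
  moreover have "0 \<le> f (\<lambda>_. 0)" by (rule empty.prems(1)) simp
  ultimately show ?case by (intro exI[of _ "\<lambda>_. f (\<lambda>_. 0)"]) simp
next
  case (insert k I)
  define g where "g = (\<lambda>l. f (l(k := 0)))"
  define h where "h = (\<lambda>l. f (l(k := 1)) - f (l(k := 0)))"
  have gh: "f (l(k := x)) = g l + x * h l" if "\<And>i. 0 \<le> l i" "0 \<le> x" for l x
  proof -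
    have "f (l(k := x)) = (1 - x) * f (l(k := 0)) + x * f (l(k := 1))"
      by (rule insert.prems(3)) (use that in auto)
    then show ?thesis unfolding g_def h_def by (simp only: algebra_simps)
  qed
  have upd: "0 \<le> (l(j := x)) i" if "\<And>i. 0 \<le> l i" "0 \<le> x" for l :: "'i \<Rightarrow> real" and j x i
    using that by simp
  have fnn: "0 \<le> f (l(k := x))" if "\<And>i. 0 \<le> l i" "0 \<le> x" for l x
    by (rule insert.prems(1)) (rule upd[OF that])
  have local: "f (l(k := x)) = f (l'(k := x))" if "\<And>i. i \<in> I \<Longrightarrow> l i = l' i" for l l' x
    by (rule insert.prems(2)) (use that in auto)
  have aff: "f (l(j := x, k := y)) = (1 - x) * f (l(j := 0, k := y)) + x * f (l(j := 1, k := y))"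
    if "\<And>i. 0 \<le> l i" "j \<in> I" "0 \<le> x" "0 \<le> y" for l j x y
  proof -
    have jk: "j \<noteq> k" using that insert.hyps by blast
    show ?thesis
      unfolding fun_upd_twist[OF jk]
      by (rule insert.prems(3)) (use that in \<open>simp_all add: upd\<close>)
  qed
  have "\<exists>a. (\<forall>J. 0 \<le> a J) \<and> (\<forall>l. (\<forall>i. 0 \<le> l i) \<longrightarrow> g l = (\<Sum>J\<in>Pow I. a J * (\<Prod>i\<in>J. l i)))"
  proof (rule insert.IH)
    show "0 \<le> g l" if "\<And>i. 0 \<le> l i" for l
      unfolding g_def using fnn[OF that] by simp
    show "g l = g l'" if "\<And>i. i \<in> I \<Longrightarrow> l i = l' i" for l l'
      unfolding g_def using that by (rule local)
    show "g (l(j := x)) = (1 - x) * g (l(j := 0)) + x * g (l(j := 1))"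
      if "\<And>i. 0 \<le> l i" "j \<in> I" "0 \<le> x" for l j x
      unfolding g_def using that by (intro aff) auto
  qed
  then obtain a where a: "\<And>J. 0 \<le> a J"
    and g: "\<And>l. (\<And>i. 0 \<le> l i) \<Longrightarrow> g l = (\<Sum>J\<in>Pow I. a J * (\<Prod>i\<in>J. l i))" by blast
  have "\<exists>b. (\<forall>J. 0 \<le> b J) \<and> (\<forall>l. (\<forall>i. 0 \<le> l i) \<longrightarrow> h l = (\<Sum>J\<in>Pow I. b J * (\<Prod>i\<in>J. l i)))"
  proof (rule insert.IH)
    show "0 \<le> h l" if "\<And>i. 0 \<le> l i" for l
    proof (rule ccontr)
      assume neg: "\<not> 0 \<le> h l"
      have g0: "0 \<le> g l" unfolding g_def using fnn[OF that] by simp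
      \<comment> \<open>an argument at which the affine function takes the value -1\<close>
      define x where "x = (g l + 1) / (- h l)"
      have x: "0 \<le> x" unfolding x_def using neg g0 by (intro divide_nonneg_nonneg) auto
      moreover have "g l + x * h l < 0" unfolding x_def using neg by (simp add: field_simps)
      ultimately show False using fnn[where l = l, OF that x] gh[where l = l, OF that x] by simp
    qed
    show "h l = h l'" if "\<And>i. i \<in> I \<Longrightarrow> l i = l' i" for l l'
    proof -
      have "f (l(k := 1)) = f (l'(k := 1))" using that by (rule local)
      moreover have "f (l(k := 0)) = f (l'(k := 0))" using that by (rule local)
      ultimately show ?thesis unfolding h_def by (simp only:)
    qed
    show "h (l(j := x)) = (1 - x) * h (l(j := 0)) + x * h (l(j := 1))"
      if "\<And>i. 0 \<le> l i" "j \<in> I" "0 \<le> x" for l j x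
      unfolding h_def aff[OF that order_refl] aff[OF that zero_le_one] by (simp only: algebra_simps)
  qed
  then obtain b where b: "\<And>J. 0 \<le> b J"
    and h: "\<And>l. (\<And>i. 0 \<le> l i) \<Longrightarrow> h l = (\<Sum>J\<in>Pow I. b J * (\<Prod>i\<in>J. l i))" by blast
  let ?c = "\<lambda>J. if k \<in> J then b (J - {k}) else a J"
  show ?case
  proof (intro exI[of _ ?c] conjI allI impI)
    show "0 \<le> ?c J" for J using a b by simp
    fix l :: "'i \<Rightarrow> real" assume "\<forall>i. 0 \<le> l i"
    then have l: "\<And>i. 0 \<le> l i" by blast
    have fin: "finite J" if "J \<in> Pow I" for J using that insert.hyps finite_subset by blast
    have notin: "k \<notin> J" if "J \<in> Pow I" for J using that insert.hyps by blast
    have "f l = g l + l k * h l" using gh[where l = l and x = "l k", OF l l] by simp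
    also have "\<dots> = (\<Sum>J\<in>Pow I. ?c J * (\<Prod>i\<in>J. l i)) + (\<Sum>J\<in>Pow I. ?c (insert k J) * (\<Prod>i\<in>insert k J. l i))"
    proof -
      have "g l = (\<Sum>J\<in>Pow I. ?c J * (\<Prod>i\<in>J. l i))"
        unfolding g[OF l] using notin by (intro sum.cong refl) simp
      moreover have "l k * h l = (\<Sum>J\<in>Pow I. ?c (insert k J) * (\<Prod>i\<in>insert k J. l i))"
        unfolding h[OF l] sum_distrib_left using notin fin by (intro sum.cong refl) simp
      ultimately show ?thesis by simp
    qed
    also have "(\<Sum>J\<in>Pow I. ?c (insert k J) * (\<Prod>i\<in>insert k J. l i))
        = (\<Sum>J\<in>insert k ` Pow I. ?c J * (\<Prod>i\<in>J. l i))"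
      using notin by (subst sum.reindex) (auto intro!: inj_onI simp: insert_ident)
    also have "(\<Sum>J\<in>Pow I. ?c J * (\<Prod>i\<in>J. l i)) + \<dots> = (\<Sum>J\<in>Pow (insert k I). ?c J * (\<Prod>i\<in>J. l i))"
      unfolding Pow_insert using insert.hyps notin
      by (intro sum.union_disjoint[symmetric]) auto
    finally show "f l = (\<Sum>J\<in>Pow (insert k I). ?c J * (\<Prod>i\<in>J. l i))" .
  qed
qed

text \<open>
The cube of an integral is an integral over three independent copies.
\<close>
lemma sum_integral_cube_nonneg:
  fixes f :: "'k \<Rightarrow> 'a \<Rightarrow> real"
  assumes int: "\<And>k. k \<in> K \<Longrightarrow> integrable M (f k)"
    and nn: "\<And>x y z. 0 \<le> (\<Sum>k\<in>K. a k * (f k x * f k y * f k z))"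
  shows "0 \<le> (\<Sum>k\<in>K. a k * (integral\<^sup>L M (f k)) ^ 3)"
proof -
  let ?F = "\<lambda>k. integral\<^sup>L M (f k)"
  have 1: "0 \<le> (\<Sum>k\<in>K. a k * (f k x * f k y * ?F k))" for x y
  proof -
    have "0 \<le> (\<integral>z. (\<Sum>k\<in>K. a k * (f k x * f k y * f k z)) \<partial>M)"
      by (rule Bochner_Integration.integral_nonneg) (rule nn)
    also have "\<dots> = (\<Sum>k\<in>K. a k * (f k x * f k y * ?F k))"
      using int by (subst Bochner_Integration.integral_sum) auto
    finally show ?thesis .
  qed
  have 2: "0 \<le> (\<Sum>k\<in>K. a k * (f k x * ?F k * ?F k))" for x
  proof -
    have "0 \<le> (\<integral>y. (\<Sum>k\<in>K. a k * (f k x * f k y * ?F k)) \<partial>M)"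
      by (rule Bochner_Integration.integral_nonneg) (rule 1)
    also have "\<dots> = (\<Sum>k\<in>K. a k * (f k x * ?F k * ?F k))"
      using int by (subst Bochner_Integration.integral_sum) auto
    finally show ?thesis .
  qed
  have "0 \<le> (\<integral>x. (\<Sum>k\<in>K. a k * (f k x * ?F k * ?F k)) \<partial>M)"
    by (rule Bochner_Integration.integral_nonneg) (rule 2)
  also have "\<dots> = (\<Sum>k\<in>K. a k * (?F k * ?F k * ?F k))"
    using int by (subst Bochner_Integration.integral_sum) auto
  finally show ?thesis by (simp add: power3_eq_cube)
qed

lemma poly_eq_sum_atMost:
  fixes p :: "real poly"
  assumes "degree p \<le> d"
  shows "poly p x = (\<Sum>m\<le>d. coeff p m * x ^ m)"
proof -
  have "(\<Sum>m\<le>d. coeff p m * x ^ m) = poly (\<Sum>m\<le>d. monom (coeff p m) m) x"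
    by (simp add: poly_sum poly_monom)
  then show ?thesis using poly_as_sum_of_monoms'[OF assms] by simp
qed

lemma euler_poly_eq_sum_atMost:
  fixes p :: "real poly"
  assumes "degree p \<le> d"
  shows "x * poly (pderiv p) x = (\<Sum>m\<le>d. coeff p m * real m * x ^ m)"
proof -
  have "degree (pCons 0 (pderiv p)) \<le> d"
  proof (cases "pderiv p = 0")
    case False
    then have "degree p \<noteq> 0" by (simp add: pderiv_eq_0_iff)
    then show ?thesis using assms by (simp add: degree_pderiv degree_pCons_eq_if)
  qed simp
  then have "poly (pCons 0 (pderiv p)) x = (\<Sum>m\<le>d. coeff (pCons 0 (pderiv p)) m * x ^ m)"
    by (rule poly_eq_sum_atMost)
  also have "\<dots> = (\<Sum>m\<le>d. coeff p m * real m * x ^ m)"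
    by (intro sum.cong refl) (auto simp: coeff_pCons coeff_pderiv split: nat.split)
  finally show ?thesis by simp
qed

text \<open>
In the expansion of \<open>\<Prod> p\<^sub>i(u\<^sub>i)\<close> into monomials, weighting the coefficient of \<open>u^k\<close> with
\<open>\<Prod>\<^sub>i\<^sub>\<in>\<^sub>J k\<^sub>i\<close> applies the operator \<open>u d/du\<close> to the factors with index in \<open>J\<close>.
\<close>
lemma prod_poly_expansion:
  fixes p :: "'i \<Rightarrow> real poly"
  assumes "finite I" "\<And>i. i \<in> I \<Longrightarrow> degree (p i) \<le> d" "J \<subseteq> I"
  shows "(\<Sum>k\<in>PiE I (\<lambda>_. {..d}). (\<Prod>i\<in>I. coeff (p i) (k i)) * (\<Prod>i\<in>J. real (k i)) * (\<Prod>i\<in>I. u i ^ k i))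
    = (\<Prod>i\<in>I. if i \<in> J then u i * poly (pderiv (p i)) (u i) else poly (p i) (u i))"
proof -
  let ?g = "\<lambda>i m. coeff (p i) m * (if i \<in> J then real m else 1) * u i ^ m"
  have "(\<Prod>i\<in>I. if i \<in> J then u i * poly (pderiv (p i)) (u i) else poly (p i) (u i))
      = (\<Prod>i\<in>I. \<Sum>m\<le>d. ?g i m)"
    using assms(2) by (intro prod.cong refl) (auto simp: euler_poly_eq_sum_atMost poly_eq_sum_atMost)
  also have "\<dots> = (\<Sum>k\<in>PiE I (\<lambda>_. {..d}). \<Prod>i\<in>I. ?g i (k i))"
    using assms(1) by (intro prod_sum_PiE) auto
  also have "\<dots> = (\<Sum>k\<in>PiE I (\<lambda>_. {..d}). (\<Prod>i\<in>I. coeff (p i) (k i)) * (\<Prod>i\<in>J. real (k i)) * (\<Prod>i\<in>I. u i ^ k i))"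
  proof (intro sum.cong refl)
    fix k
    have "(\<Prod>i\<in>I. if i \<in> J then real (k i) else 1) = (\<Prod>i\<in>J. real (k i))"
      using assms by (simp add: prod.If_cases Int_absorb1)
    then show "(\<Prod>i\<in>I. ?g i (k i)) = (\<Prod>i\<in>I. coeff (p i) (k i)) * (\<Prod>i\<in>J. real (k i)) * (\<Prod>i\<in>I. u i ^ k i)"
      by (simp add: prod.distrib)
  qed
  finally show ?thesis ..
qed

definition increasing_poly :: "real poly \<Rightarrow> bool" where
  "increasing_poly p \<longleftrightarrow> (\<forall>u\<in>{0..1}. 0 \<le> poly p u \<and> 0 \<le> poly (pderiv p) u)"

text \<open>
The positivity that drives the argument: for three independent copies of the \<open>u\<^sub>i\<close>, with
coordinatewise product \<open>w\<close>, the sum is the expectation of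
\<open>\<Sum>\<^sub>J a\<^sub>J \<Prod>\<^sub>i\<^sub>\<in>\<^sub>J w\<^sub>i p\<^sub>i'(w\<^sub>i) \<Prod>\<^sub>i\<^sub>\<notin>\<^sub>J p\<^sub>i(w\<^sub>i)\<close>.
\<close>
lemma moment_cube_sum_nonneg:
  fixes p :: "'i \<Rightarrow> real poly"
  assumes P: "prob_space N" and fin: "finite I"
    and deg: "\<And>i. i \<in> I \<Longrightarrow> degree (p i) \<le> d" and inc: "\<And>i. i \<in> I \<Longrightarrow> increasing_poly (p i)"
    and u: "\<And>i. i \<in> I \<Longrightarrow> u i \<in> borel_measurable N"
    and u01: "\<And>i \<omega>. i \<in> I \<Longrightarrow> 0 \<le> u i \<omega> \<and> u i \<omega> \<le> 1"
    and a: "\<And>J. 0 \<le> a J"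
  shows "0 \<le> (\<Sum>k\<in>PiE I (\<lambda>_. {..d}). (\<Prod>i\<in>I. coeff (p i) (k i)) * (\<Sum>J\<in>Pow I. a J * (\<Prod>i\<in>J. real (k i)))
      * (\<integral>\<omega>. (\<Prod>i\<in>I. u i \<omega> ^ k i) \<partial>N) ^ 3)"
proof (rule sum_integral_cube_nonneg)
  interpret prob_space N by fact
  fix k
  show "integrable N (\<lambda>\<omega>. \<Prod>i\<in>I. u i \<omega> ^ k i)"
  proof (rule integrable_const_bound[where B = 1])
    have "norm (\<Prod>i\<in>I. u i \<omega> ^ k i) \<le> 1" for \<omega>
    proof -
      have "0 \<le> (\<Prod>i\<in>I. u i \<omega> ^ k i)" using u01 by (intro prod_nonneg) auto
      moreover have "(\<Prod>i\<in>I. u i \<omega> ^ k i) \<le> 1" using u01 by (intro prod_le_1) (auto intro: power_le_one)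
      ultimately show ?thesis by simp
    qed
    then show "AE \<omega> in N. norm (\<Prod>i\<in>I. u i \<omega> ^ k i) \<le> 1" by simp
    show "(\<lambda>\<omega>. \<Prod>i\<in>I. u i \<omega> ^ k i) \<in> borel_measurable N"
      using u by (intro borel_measurable_prod borel_measurable_power)
  qed
next
  fix x y z
  define w where "w = (\<lambda>i. u i x * u i y * u i z)"
  have w: "0 \<le> w i" "w i \<le> 1" if "i \<in> I" for i
    unfolding w_def using u01[OF that] by (auto intro!: mult_le_one)
  let ?K = "PiE I (\<lambda>_. {..d})"
  have "(\<Sum>k\<in>?K. (\<Prod>i\<in>I. coeff (p i) (k i)) * (\<Sum>J\<in>Pow I. a J * (\<Prod>i\<in>J. real (k i)))
      * ((\<Prod>i\<in>I. u i x ^ k i) * (\<Prod>i\<in>I. u i y ^ k i) * (\<Prod>i\<in>I. u i z ^ k i)))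
    = (\<Sum>k\<in>?K. \<Sum>J\<in>Pow I. a J * ((\<Prod>i\<in>I. coeff (p i) (k i)) * (\<Prod>i\<in>J. real (k i)) * (\<Prod>i\<in>I. w i ^ k i)))"
    unfolding w_def power_mult_distrib prod.distrib sum_distrib_left sum_distrib_right
    by (intro sum.cong refl) (simp only: mult_ac)
  also have "\<dots> = (\<Sum>J\<in>Pow I. a J * (\<Sum>k\<in>?K. (\<Prod>i\<in>I. coeff (p i) (k i)) * (\<Prod>i\<in>J. real (k i)) * (\<Prod>i\<in>I. w i ^ k i)))"
    unfolding sum_distrib_left by (rule sum.swap)
  also have "\<dots> = (\<Sum>J\<in>Pow I. a J * (\<Prod>i\<in>I. if i \<in> J then w i * poly (pderiv (p i)) (w i) else poly (p i) (w i)))"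
    using fin deg by (intro sum.cong refl arg_cong2[where f = "(*)"] prod_poly_expansion) auto
  also have "\<dots> \<ge> 0"
    using w inc unfolding increasing_poly_def
    by (intro sum_nonneg mult_nonneg_nonneg a prod_nonneg) auto
  finally show "0 \<le> (\<Sum>k\<in>?K. (\<Prod>i\<in>I. coeff (p i) (k i)) * (\<Sum>J\<in>Pow I. a J * (\<Prod>i\<in>J. real (k i)))
      * ((\<Prod>i\<in>I. u i x ^ k i) * (\<Prod>i\<in>I. u i y ^ k i) * (\<Prod>i\<in>I. u i z ^ k i)))" .
qed

section \<open>Monotonicity in the covariance between the blocks\<close>

text \<open>
The coefficients \<open>a\<close> come from the derivative of \<open>gauss_det\<close>, which inherits from \<open>gauss_det\<close> that
it is affine in every coordinate and has a sign because \<open>gauss_det\<close> is nonincreasing in the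
parameter. The factor in front and the third power come from differentiating the power
\<open>-1/2\<close> of \<open>gauss_det\<close>.
\<close>
lemma gauss_lap_interp_deriv:
  assumes fin: "finite I" and psd: "psd_on I C" and \<tau>: "0 < \<tau>" "\<tau> < 1"
  shows "\<exists>a. (\<forall>J. 0 \<le> a J) \<and> (\<forall>l. (\<forall>i. 0 \<le> l i) \<longrightarrow>
    ((\<lambda>s. gauss_lap I (interp_cov A C s) l) has_real_derivative
      (\<Sum>J\<in>Pow I. a J * (\<Prod>i\<in>J. l i)) / 2 * (gauss_lap I (interp_cov A C \<tau>) l) ^ 3) (at \<tau>))"
proof -
  define D where "D = (\<lambda>s l. gauss_det I (interp_cov A C s) l)"
  define f where "f = (\<lambda>l. - deriv (\<lambda>s. D s l) \<tau>)"
  have psdT: "psd_on I (interp_cov A C s)" if "s \<in> {- 1<..<1}" for s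
    using that by (intro psd_on_interp_cov psd) auto
  have D: "((\<lambda>s. D s l) has_real_derivative - f l) (at \<tau>)" if l: "\<And>i. 0 \<le> l i" for l
  proof -
    have "(\<lambda>s. D s l) differentiable_on {- 1<..<1}"
      unfolding D_def
    proof (rule gauss_det_differentiable_on[OF fin psdT l])
      show "(\<lambda>s. interp_cov A C s i j) differentiable_on {- 1<..<1}" for i j
        unfolding interp_cov_def by (cases "i \<in> A \<longleftrightarrow> j \<in> A") (auto intro!: derivative_intros)
    qed
    then have "(\<lambda>s. D s l) differentiable (at \<tau>)"
      using \<tau> by (simp add: differentiable_on_eq_differentiable_at)
    then show ?thesis unfolding f_def by (simp add: DERIV_deriv_iff_real_differentiable)
  qed
  have "\<exists>a. (\<forall>J. 0 \<le> a J) \<and> (\<forall>l. (\<forall>i. 0 \<le> l i) \<longrightarrow> f l = (\<Sum>J\<in>Pow I. a J * (\<Prod>i\<in>J. l i)))"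
  proof (rule nonneg_multiaffine_expansion[OF fin])
    show "f l = f l'" if "\<And>i. i \<in> I \<Longrightarrow> l i = l' i" for l l'
    proof -
      have "D s l = D s l'" for s unfolding D_def using that by (intro gauss_det_cong) auto
      then show ?thesis unfolding f_def by simp
    qed
  next
    fix l :: "'a \<Rightarrow> real" assume l: "\<And>i. 0 \<le> l i"
    show "0 \<le> f l"
    proof (rule ccontr)
      assume "\<not> 0 \<le> f l"
      then have "0 < - f l" by simp
      from DERIV_pos_inc_right[OF D[where l = l, OF l] this] obtain d where d: "d > 0"
        and inc: "\<And>h. 0 < h \<Longrightarrow> h < d \<Longrightarrow> D \<tau> l < D (\<tau> + h) l" by blast
      define h where "h = min (d / 2) (1 - \<tau>)"
      have h: "0 < h" "h < d" "\<tau> + h \<le> 1" unfolding h_def using d \<tau> by auto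
      have "gauss_lap I (interp_cov A C \<tau>) l \<le> gauss_lap I (interp_cov A C (\<tau> + h)) l"
        using \<tau> h by (intro gauss_lap_interp_mono fin psd l) auto
      moreover have "0 < gauss_lap I (interp_cov A C \<tau>) l"
        using \<tau> by (intro gauss_lap_pos psdT) auto
      ultimately have "D (\<tau> + h) l \<le> D \<tau> l"
        unfolding D_def gauss_det_def by (intro divide_left_mono power_mono) auto
      then show False using inc[OF h(1,2)] by simp
    qed
  next
    fix l :: "'a \<Rightarrow> real" and k and x :: real
    assume l: "\<And>i. 0 \<le> l i" and k: "k \<in> I" and x: "0 \<le> x"
    have upd: "0 \<le> (l(k := y)) i" if "0 \<le> y" for y i using l that by simp
    have aff: "(1 - x) * D s (l(k := 0)) + x * D s (l(k := 1)) = D s (l(k := x))"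
      if "s \<in> {- 1<..<1}" for s
    proof -
      have I: "insert k (I - {k}) = I" using k by blast
      show ?thesis
        using gauss_det_affine[where I = "I - {k}" and k = k and C = "interp_cov A C s" and l = l and x = x]
          fin psdT[OF that] l x unfolding I D_def by simp
    qed
    have "((\<lambda>s. (1 - x) * D s (l(k := 0)) + x * D s (l(k := 1))) has_real_derivative
        (1 - x) * (- f (l(k := 0))) + x * (- f (l(k := 1)))) (at \<tau>)"
      by (intro DERIV_add DERIV_cmult D upd) auto
    then have "((\<lambda>s. D s (l(k := x))) has_real_derivative
        (1 - x) * (- f (l(k := 0))) + x * (- f (l(k := 1)))) (at \<tau>)"
      by (rule has_field_derivative_transform_within_open[where S = "{- 1<..<1}"])
        (use \<tau> aff in auto)
    from DERIV_unique[OF this D[OF upd[OF x]]]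
    show "f (l(k := x)) = (1 - x) * f (l(k := 0)) + x * f (l(k := 1))"
      by (simp only: mult_minus_right minus_add_distrib[symmetric] neg_equal_iff_equal)
  qed
  then obtain a where a: "\<And>J. 0 \<le> a J"
    and f: "\<And>l. (\<And>i. 0 \<le> l i) \<Longrightarrow> f l = (\<Sum>J\<in>Pow I. a J * (\<Prod>i\<in>J. l i))" by blast
  show ?thesis
  proof (intro exI[of _ a] conjI allI impI a)
    fix l :: "'a \<Rightarrow> real" assume "\<forall>i. 0 \<le> l i"
    then have l: "\<And>i. 0 \<le> l i" by blast
    have lap: "1 / sqrt (D s l) = gauss_lap I (interp_cov A C s) l" if "s \<in> {- 1<..<1}" for s
      unfolding D_def using gauss_lap_eq_gauss_det[OF psdT[OF that]] by simp
    have \<tau>': "\<tau> \<in> {- 1<..<1}" using \<tau> by simp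
    have pos: "0 < D \<tau> l" unfolding D_def by (rule gauss_det_pos[OF psdT[OF \<tau>']])
    have "((\<lambda>s. 1 / sqrt (D s l)) has_real_derivative f l / 2 * (1 / sqrt (D \<tau> l)) ^ 3) (at \<tau>)"
      using D[where l = l, OF l] pos
      by (auto intro!: derivative_eq_intros simp: field_simps power3_eq_cube)
    then show "((\<lambda>s. gauss_lap I (interp_cov A C s) l) has_real_derivative
      (\<Sum>J\<in>Pow I. a J * (\<Prod>i\<in>J. l i)) / 2 * (gauss_lap I (interp_cov A C \<tau>) l) ^ 3) (at \<tau>)"
      unfolding lap[OF \<tau>'] f[OF l]
      by (rule has_field_derivative_transform_within_open[where S = "{- 1<..<1}"])
        (use \<tau>' lap in auto)
  qed
qed

lemma gauss_lap_interp_continuous: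
  assumes fin: "finite I" and psd: "psd_on I C" and l: "\<And>i. 0 \<le> l i"
  shows "continuous_on {0..1} (\<lambda>s. gauss_lap I (interp_cov A C s) l)"
proof -
  have psdT: "psd_on I (interp_cov A C s)" if "s \<in> {0..1}" for s
    using that by (intro psd_on_interp_cov psd) auto
  have "(\<lambda>s. gauss_det I (interp_cov A C s) l) differentiable_on {0..1}"
  proof (rule gauss_det_differentiable_on[OF fin psdT l])
    show "(\<lambda>s. interp_cov A C s i j) differentiable_on {0..1}" for i j
      unfolding interp_cov_def by (cases "i \<in> A \<longleftrightarrow> j \<in> A") (auto intro!: derivative_intros)
  qed
  then have "continuous_on {0..1} (\<lambda>s. gauss_det I (interp_cov A C s) l)"
    by (rule differentiable_imp_continuous_on)
  then have "continuous_on {0..1} (\<lambda>s. 1 / sqrt (gauss_det I (interp_cov A C s) l))"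
    using gauss_det_pos[OF psdT] by (intro continuous_intros) (auto simp: less_imp_neq[symmetric])
  moreover have "1 / sqrt (gauss_det I (interp_cov A C s) l) = gauss_lap I (interp_cov A C s) l"
    if "s \<in> {0..1}" for s
    using gauss_lap_eq_gauss_det[OF psdT[OF that]] by simp
  ultimately show ?thesis by (metis (no_types, lifting) continuous_on_cong)
qed

lemma integral_prod_exp_power:
  assumes P: "prob_space N" and fin: "finite I" and Y: "has_gauss_char N I Y C"
  shows "(\<integral>\<omega>. (\<Prod>i\<in>I. exp (- (Y i \<omega>)\<^sup>2 / 2) ^ k i) \<partial>N) = gauss_lap I C (\<lambda>i. real (k i))"
    and "integrable N (\<lambda>\<omega>. \<Prod>i\<in>I. exp (- (Y i \<omega>)\<^sup>2 / 2) ^ k i)"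
proof -
  interpret prob_space N by fact
  have eq: "(\<Prod>i\<in>I. exp (- (Y i \<omega>)\<^sup>2 / 2) ^ k i) = exp (- (\<Sum>i\<in>I. real (k i) * (Y i \<omega>)\<^sup>2) / 2)" for \<omega>
    by (simp add: exp_sum[OF fin] exp_of_nat_mult[symmetric] sum_negf[symmetric] sum_divide_distrib)
  show "(\<integral>\<omega>. (\<Prod>i\<in>I. exp (- (Y i \<omega>)\<^sup>2 / 2) ^ k i) \<partial>N) = gauss_lap I C (\<lambda>i. real (k i))"
    unfolding eq by (rule integral_exp_neg_squares[OF P fin Y]) simp
  show "integrable N (\<lambda>\<omega>. \<Prod>i\<in>I. exp (- (Y i \<omega>)\<^sup>2 / 2) ^ k i)"
    unfolding eq
  proof (rule integrable_const_bound[where B = 1])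
    show "AE \<omega> in N. norm (exp (- (\<Sum>i\<in>I. real (k i) * (Y i \<omega>)\<^sup>2) / 2)) \<le> 1"
      by (intro AE_I2) (simp add: sum_nonneg)
    show "(\<lambda>\<omega>. exp (- (\<Sum>i\<in>I. real (k i) * (Y i \<omega>)\<^sup>2) / 2)) \<in> borel_measurable N"
      using has_gauss_charD(1)[OF Y] by measurable
  qed
qed

lemma integral_prod_poly_exp:
  fixes p :: "'i \<Rightarrow> real poly"
  assumes P: "prob_space N" and fin: "finite I" and Y: "has_gauss_char N I Y C"
    and deg: "\<And>i. i \<in> I \<Longrightarrow> degree (p i) \<le> d"
  shows "integrable N (\<lambda>\<omega>. \<Prod>i\<in>I. poly (p i) (exp (- (Y i \<omega>)\<^sup>2 / 2)))"
    and "(\<integral>\<omega>. (\<Prod>i\<in>I. poly (p i) (exp (- (Y i \<omega>)\<^sup>2 / 2))) \<partial>N)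
      = (\<Sum>k\<in>PiE I (\<lambda>_. {..d}). (\<Prod>i\<in>I. coeff (p i) (k i)) * gauss_lap I C (\<lambda>i. real (k i)))"
proof -
  have eq: "(\<Prod>i\<in>I. poly (p i) (exp (- (Y i \<omega>)\<^sup>2 / 2)))
      = (\<Sum>k\<in>PiE I (\<lambda>_. {..d}). (\<Prod>i\<in>I. coeff (p i) (k i)) * (\<Prod>i\<in>I. exp (- (Y i \<omega>)\<^sup>2 / 2) ^ k i))" for \<omega>
    using prod_poly_expansion[where J = "{}" and u = "\<lambda>i. exp (- (Y i \<omega>)\<^sup>2 / 2)", OF fin deg] by simp
  show "integrable N (\<lambda>\<omega>. \<Prod>i\<in>I. poly (p i) (exp (- (Y i \<omega>)\<^sup>2 / 2)))"
    unfolding eq by (intro Bochner_Integration.integrable_sum integrable_mult_right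
        integral_prod_exp_power(2)[OF P fin Y])
  show "(\<integral>\<omega>. (\<Prod>i\<in>I. poly (p i) (exp (- (Y i \<omega>)\<^sup>2 / 2))) \<partial>N)
      = (\<Sum>k\<in>PiE I (\<lambda>_. {..d}). (\<Prod>i\<in>I. coeff (p i) (k i)) * gauss_lap I C (\<lambda>i. real (k i)))"
    unfolding eq
    by (subst Bochner_Integration.integral_sum)
      (simp_all only: integral_mult_right_zero integral_prod_exp_power[OF P fin Y]
        integrable_mult_right)
qed

text \<open>
The function \<open>H\<close> below is the expectation of the product over \<open>A \<union> B\<close> along the interpolation of
the covariance. It is nondecreasing, and its values at the endpoints 0 and 1 are the two
sides of the inequality.
\<close>
lemma correlation_increasing_poly:
  fixes p :: "'i \<Rightarrow> real poly"
  assumes P: "prob_space M" and fin: "finite A" "finite B" and dis: "A \<inter> B = {}"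
    and psd: "psd_on (A \<union> B) C" and X: "has_gauss_char M (A \<union> B) X C"
    and inc: "\<And>i. i \<in> A \<union> B \<Longrightarrow> increasing_poly (p i)"
  shows "(\<integral>\<omega>. (\<Prod>i\<in>A. poly (p i) (exp (- (X i \<omega>)\<^sup>2 / 2))) \<partial>M)
       * (\<integral>\<omega>. (\<Prod>i\<in>B. poly (p i) (exp (- (X i \<omega>)\<^sup>2 / 2))) \<partial>M)
      \<le> (\<integral>\<omega>. (\<Prod>i\<in>A \<union> B. poly (p i) (exp (- (X i \<omega>)\<^sup>2 / 2))) \<partial>M)"
proof -
  interpret M: prob_space M by fact
  interpret pair_prob_space M M ..
  let ?I = "A \<union> B"
  have finI: "finite ?I" using fin by simp
  define d where "d = (\<Sum>i\<in>?I. degree (p i))"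
  have deg: "degree (p i) \<le> d" if "i \<in> ?I" for i
    unfolding d_def using finI that by (intro member_le_sum) auto
  let ?K = "PiE ?I (\<lambda>_. {..d})"
  let ?c = "\<lambda>k. \<Prod>i\<in>?I. coeff (p i) (k i)"
  define H where "H = (\<lambda>s. \<Sum>k\<in>?K. ?c k * gauss_lap ?I (interp_cov A C s) (\<lambda>i. real (k i)))"
  note char = has_gauss_char_interp_vec[OF P finI X]
  have "H 0 \<le> H 1"
  proof (rule DERIV_nonneg_imp_increasing_open[where f = H])
    show "continuous_on {0..1} H"
      unfolding H_def by (intro continuous_intros gauss_lap_interp_continuous finI psd) auto
    fix \<tau> :: real assume \<tau>: "0 < \<tau>" "\<tau> < 1"
    obtain a where a: "\<And>J. 0 \<le> a J"
      and deriv: "\<And>l. (\<And>i. 0 \<le> l i) \<Longrightarrow> ((\<lambda>s. gauss_lap ?I (interp_cov A C s) l) has_real_derivative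
        (\<Sum>J\<in>Pow ?I. a J * (\<Prod>i\<in>J. l i)) / 2 * (gauss_lap ?I (interp_cov A C \<tau>) l) ^ 3) (at \<tau>)"
      using gauss_lap_interp_deriv[OF finI psd \<tau>, of A] by blast
    have \<tau>1: "\<bar>\<tau>\<bar> \<le> 1" using \<tau> by simp
    let ?H' = "\<Sum>k\<in>?K. ?c k * ((\<Sum>J\<in>Pow ?I. a J * (\<Prod>i\<in>J. real (k i))) / 2
          * (gauss_lap ?I (interp_cov A C \<tau>) (\<lambda>i. real (k i))) ^ 3)"
    have "(H has_real_derivative ?H') (at \<tau>)"
      unfolding H_def by (intro DERIV_sum DERIV_cmult deriv) simp
    moreover have "0 \<le> ?H'"
    proof -
      have "0 \<le> (\<Sum>k\<in>?K. ?c k * (\<Sum>J\<in>Pow ?I. a J * (\<Prod>i\<in>J. real (k i)))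
          * (\<integral>\<omega>. (\<Prod>i\<in>?I. exp (- (interp_vec A X \<tau> i \<omega>)\<^sup>2 / 2) ^ k i) \<partial>(M \<Otimes>\<^sub>M M)) ^ 3)"
      proof (rule moment_cube_sum_nonneg[OF P.prob_space_axioms finI deg inc _ _ a])
        show "(\<lambda>\<omega>. exp (- (interp_vec A X \<tau> i \<omega>)\<^sup>2 / 2)) \<in> borel_measurable (M \<Otimes>\<^sub>M M)" if "i \<in> ?I" for i
          using has_gauss_charD(1)[OF char[OF \<tau>1] that] by measurable
      qed auto
      also have "\<dots> = 2 * ?H'"
        unfolding integral_prod_exp_power(1)[OF P.prob_space_axioms finI char[OF \<tau>1]]
          sum_distrib_left[of "2::real"]
        by (intro sum.cong refl) simp
      finally show ?thesis by simp
    qed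
    ultimately show "\<exists>y. (H has_real_derivative y) (at \<tau>) \<and> 0 \<le> y" by blast
  qed simp
  moreover have "H 1 = (\<integral>\<omega>. (\<Prod>i\<in>?I. poly (p i) (exp (- (X i \<omega>)\<^sup>2 / 2))) \<partial>M)"
    unfolding H_def interp_cov_1 by (rule integral_prod_poly_exp(2)[OF P finI X deg, symmetric])
  moreover have "H 0 = (\<integral>\<omega>. (\<Prod>i\<in>A. poly (p i) (exp (- (X i \<omega>)\<^sup>2 / 2))) \<partial>M)
       * (\<integral>\<omega>. (\<Prod>i\<in>B. poly (p i) (exp (- (X i \<omega>)\<^sup>2 / 2))) \<partial>M)"
  proof -
    have zero: "\<bar>0 :: real\<bar> \<le> 1" by simp
    have split: "(\<Prod>i\<in>?I. poly (p i) (exp (- (interp_vec A X 0 i (\<omega>, \<omega>'))\<^sup>2 / 2)))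
        = (\<Prod>i\<in>A. poly (p i) (exp (- (X i \<omega>)\<^sup>2 / 2))) * (\<Prod>i\<in>B. poly (p i) (exp (- (X i \<omega>')\<^sup>2 / 2)))"
      for \<omega> \<omega>'
    proof -
      have "i \<notin> A" if "i \<in> B" for i using that dis by blast
      then show ?thesis
        unfolding prod.union_disjoint[OF fin dis] interp_vec_def by simp
    qed
    have "H 0 = (\<integral>\<omega>. (\<Prod>i\<in>?I. poly (p i) (exp (- (interp_vec A X 0 i \<omega>)\<^sup>2 / 2))) \<partial>(M \<Otimes>\<^sub>M M))"
      unfolding H_def by (rule integral_prod_poly_exp(2)[OF P.prob_space_axioms finI char[OF zero] deg, symmetric])
    also have "\<dots> = (\<integral>\<omega>. \<integral>\<omega>'. (\<Prod>i\<in>?I. poly (p i) (exp (- (interp_vec A X 0 i (\<omega>, \<omega>'))\<^sup>2 / 2))) \<partial>M \<partial>M)"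
      by (rule integral_fst'[symmetric])
        (rule integral_prod_poly_exp(1)[OF P.prob_space_axioms finI char[OF zero] deg])
    finally show ?thesis
      unfolding split integral_mult_right_zero integral_mult_left_zero .
  qed
  ultimately show ?thesis by simp
qed

section \<open>From polynomials to boxes\<close>

text \<open>
With the exponent \<open>b\<close> close to \<open>(1 / c) ^ m\<close>, the power \<open>(1 - u ^ m) ^ b\<close> behaves like
\<open>exp (- ((u / c) ^ m))\<close>, which tends to 1 for \<open>u < c\<close> and to 0 for \<open>u > c\<close>.
\<close>
definition step_poly :: "real \<Rightarrow> nat \<Rightarrow> real poly" where
  "step_poly c m = 1 - (1 - monom 1 m) ^ nat \<lceil>(1 / c) ^ m\<rceil>"

lemma poly_step_poly: "poly (step_poly c m) u = 1 - (1 - u ^ m) ^ nat \<lceil>(1 / c) ^ m\<rceil>"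
  unfolding step_poly_def by (simp add: poly_monom)

lemma poly_step_poly_bounds:
  assumes "0 \<le> u" "u \<le> 1"
  shows "0 \<le> poly (step_poly c m) u" "poly (step_poly c m) u \<le> 1"
proof -
  have "0 \<le> 1 - u ^ m" "1 - u ^ m \<le> 1" using assms by (auto intro: power_le_one)
  then show "0 \<le> poly (step_poly c m) u" "poly (step_poly c m) u \<le> 1"
    unfolding poly_step_poly by (auto intro: power_le_one)
qed

lemma increasing_poly_step_poly: "increasing_poly (step_poly c m)"
  unfolding increasing_poly_def
proof (intro ballI conjI)
  fix u :: real assume u: "u \<in> {0..1}"
  then show "0 \<le> poly (step_poly c m) u" using poly_step_poly_bounds by simp
  have "u ^ m \<le> 1" using u by (auto intro: power_le_one)
  then show "0 \<le> poly (pderiv (step_poly c m)) u"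
    unfolding step_poly_def using u
    by (simp add: pderiv_diff pderiv_power pderiv_monom poly_monom)
qed

lemma step_poly_tendsto:
  assumes c: "0 < c" "c < 1" and u: "0 \<le> u" "u \<le> 1" "u \<noteq> c"
  shows "(\<lambda>m. poly (step_poly c m) u) \<longlonglongrightarrow> (if c < u then 1 else 0)"
proof (cases "c < u")
  case True
  have up: "0 < u" using True c by simp
  have le: "(1 - u ^ m) ^ nat \<lceil>(1 / c) ^ m\<rceil> \<le> (c / u) ^ m" for m
  proof -
    let ?b = "nat \<lceil>(1 / c) ^ m\<rceil>"
    have b: "(1 / c) ^ m \<le> real ?b" by linarith
    have "0 \<le> 1 - u ^ m" using u by (auto intro: power_le_one)
    then have "(1 - u ^ m) ^ ?b \<le> exp (- (u ^ m)) ^ ?b"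
      using exp_ge_add_one_self[of "- (u ^ m)"] by (intro power_mono) auto
    also have "\<dots> = exp (- (real ?b * u ^ m))" by (simp add: exp_of_nat_mult[symmetric])
    also have "\<dots> \<le> exp (- ((1 / c) ^ m * u ^ m))" using b up by simp
    also have "(1 / c) ^ m * u ^ m = (u / c) ^ m" by (simp add: power_divide)
    also have "exp (- ((u / c) ^ m)) \<le> 1 / (u / c) ^ m"
    proof -
      have "0 < (u / c) ^ m" using up c by simp
      moreover have "(u / c) ^ m \<le> exp ((u / c) ^ m)"
        using exp_ge_add_one_self[of "(u / c) ^ m"] by linarith
      ultimately show ?thesis unfolding exp_minus inverse_eq_divide by (intro divide_left_mono) auto
    qed
    also have "\<dots> = (c / u) ^ m" by (simp add: power_divide)
    finally show ?thesis .
  qed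
  have lim: "(\<lambda>m. (c / u) ^ m) \<longlonglongrightarrow> 0"
    using True c by (intro LIMSEQ_power_zero) auto
  have "(\<lambda>m. (1 - u ^ m) ^ nat \<lceil>(1 / c) ^ m\<rceil>) \<longlonglongrightarrow> 0"
    by (rule tendsto_sandwich[OF _ _ tendsto_const lim])
      (use le u in \<open>auto intro!: always_eventually zero_le_power power_le_one\<close>)
  then have "(\<lambda>m. 1 - (1 - u ^ m) ^ nat \<lceil>(1 / c) ^ m\<rceil>) \<longlonglongrightarrow> 1 - 0"
    by (intro tendsto_intros)
  then show ?thesis using True unfolding poly_step_poly by simp
next
  case False
  then have uc: "u < c" using u by simp
  have le: "poly (step_poly c m) u \<le> (u / c) ^ m + u ^ m" for m
  proof -
    let ?b = "nat \<lceil>(1 / c) ^ m\<rceil>"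
    have "0 \<le> (1 / c) ^ m" using c by simp
    then have b: "real ?b \<le> (1 / c) ^ m + 1" by linarith
    have "- 1 \<le> - (u ^ m)" using u by (auto intro: power_le_one)
    from Bernoulli_inequality[OF this, of ?b]
    have "poly (step_poly c m) u \<le> real ?b * u ^ m" unfolding poly_step_poly by simp
    also have "\<dots> \<le> ((1 / c) ^ m + 1) * u ^ m" using b u by (intro mult_right_mono) auto
    also have "\<dots> = (u / c) ^ m + u ^ m" by (simp add: power_divide algebra_simps)
    finally show ?thesis .
  qed
  have "(\<lambda>m. (u / c) ^ m + u ^ m) \<longlonglongrightarrow> 0 + 0"
    using u uc c by (intro tendsto_add LIMSEQ_power_zero) auto
  then have lim: "(\<lambda>m. (u / c) ^ m + u ^ m) \<longlonglongrightarrow> 0" by simp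
  have "(\<lambda>m. poly (step_poly c m) u) \<longlonglongrightarrow> 0"
    by (rule tendsto_sandwich[OF _ _ tendsto_const lim])
      (use le poly_step_poly_bounds[OF u(1,2)] in \<open>auto intro!: always_eventually\<close>)
  then show ?thesis using False by simp
qed

lemma centered_normal_rv_no_atom:
  assumes P: "prob_space M" and Y: "centered_normal_rv M Y" and t: "t \<noteq> 0"
  shows "AE \<omega> in M. Y \<omega> \<noteq> t"
proof (cases "AE \<omega> in M. Y \<omega> = 0")
  case True
  then show ?thesis by eventually_elim (use t in simp)
next
  case False
  then obtain s where D: "distributed M lborel Y (normal_density 0 s)"
    using Y unfolding centered_normal_rv_def by blast
  have "AE x in lborel. x \<noteq> t" by (rule AE_lborel_singleton)
  then have "AE x in density lborel (normal_density 0 s). x \<noteq> t"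
    by (subst AE_density) auto
  then have "AE x in distr M lborel Y. x \<noteq> t"
    unfolding distributed_distr_eq_density[OF D] .
  then show ?thesis
    using Y unfolding centered_normal_rv_def by (subst (asm) AE_distr_iff) auto
qed

lemma centered_gaussian_vector_component:
  assumes "centered_gaussian_vector M I X" "i \<in> I"
  shows "centered_normal_rv M (X i)"
proof -
  have fin: "finite I" and lin: "\<forall>a. centered_normal_rv M (\<lambda>\<omega>. \<Sum>j\<in>I. a j * X j \<omega>)"
    using assms(1) unfolding centered_gaussian_vector_def by blast+
  have "centered_normal_rv M (\<lambda>\<omega>. \<Sum>j\<in>I. (if j = i then 1 else 0) * X j \<omega>)"
    by (rule spec[OF lin])
  moreover have "(\<Sum>j\<in>I. (if j = i then 1 else 0) * X j \<omega>) = X i \<omega>" for \<omega>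
    using fin assms(2) by (simp add: if_distrib[of "\<lambda>x. x * _"] cong: if_cong)
  ultimately show ?thesis by simp
qed

text \<open>
The polynomials converge off the threshold, so the boundary of the box must be a null set. This is
also true for degenerate coordinates, whose only atom 0 lies inside the box.
\<close>
lemma integral_step_poly_tendsto:
  assumes P: "prob_space M" and X: "centered_gaussian_vector M I X"
    and t: "\<And>i. i \<in> I \<Longrightarrow> 0 < t i" and S: "S \<subseteq> I"
  shows "(\<lambda>m. \<integral>\<omega>. (\<Prod>i\<in>S. poly (step_poly (exp (- (t i)\<^sup>2 / 2)) m) (exp (- (X i \<omega>)\<^sup>2 / 2))) \<partial>M)
    \<longlonglongrightarrow> measure M {\<omega> \<in> space M. \<forall>i\<in>S. \<bar>X i \<omega>\<bar> \<le> t i}"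
proof -
  interpret prob_space M by fact
  let ?f = "\<lambda>m \<omega>. \<Prod>i\<in>S. poly (step_poly (exp (- (t i)\<^sup>2 / 2)) m) (exp (- (X i \<omega>)\<^sup>2 / 2))"
  let ?E = "{\<omega> \<in> space M. \<forall>i\<in>S. \<bar>X i \<omega>\<bar> \<le> t i}"
  have finS: "finite S" and meas: "\<And>i. i \<in> S \<Longrightarrow> X i \<in> borel_measurable M"
    using X S finite_subset unfolding centered_gaussian_vector_def by blast+
  have E: "?E \<in> sets M" using finS meas by measurable
  have fm: "?f m \<in> borel_measurable M" for m
  proof (intro borel_measurable_prod)
    fix i assume "i \<in> S"
    from meas[OF this] show "(\<lambda>\<omega>. poly (step_poly (exp (- (t i)\<^sup>2 / 2)) m) (exp (- (X i \<omega>)\<^sup>2 / 2))) \<in> borel_measurable M"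
      unfolding poly_step_poly by measurable
  qed
  have ae: "AE \<omega> in M. \<forall>i\<in>S. X i \<omega> \<noteq> t i \<and> X i \<omega> \<noteq> - t i"
  proof (rule AE_finite_allI[OF finS])
    fix i assume i: "i \<in> S"
    have Y: "centered_normal_rv M (X i)"
      using centered_gaussian_vector_component[OF X] i S by blast
    have ti: "t i \<noteq> 0" "- t i \<noteq> 0" using t i S by force+
    show "AE \<omega> in M. X i \<omega> \<noteq> t i \<and> X i \<omega> \<noteq> - t i"
      using centered_normal_rv_no_atom[OF P Y ti(1)] centered_normal_rv_no_atom[OF P Y ti(2)] by auto
  qed
  have lim: "(\<lambda>m. ?f m \<omega>) \<longlonglongrightarrow> indicator ?E \<omega>"
    if w: "\<omega> \<in> space M" "\<forall>i\<in>S. X i \<omega> \<noteq> t i \<and> X i \<omega> \<noteq> - t i" for \<omega>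
  proof -
    have "(\<lambda>m. poly (step_poly (exp (- (t i)\<^sup>2 / 2)) m) (exp (- (X i \<omega>)\<^sup>2 / 2)))
        \<longlonglongrightarrow> (if \<bar>X i \<omega>\<bar> \<le> t i then 1 else 0)" if i: "i \<in> S" for i
    proof -
      have ti: "0 < t i" using t i S by blast
      have ne: "\<bar>X i \<omega>\<bar> \<noteq> t i" using w(2) i by (auto simp: abs_if split: if_splits)
      have "(X i \<omega>)\<^sup>2 < (t i)\<^sup>2 \<longleftrightarrow> \<bar>X i \<omega>\<bar> < t i"
        using abs_le_square_iff[of "t i" "X i \<omega>"] ti by (simp add: not_le[symmetric])
      then have iff: "exp (- (t i)\<^sup>2 / 2) < exp (- (X i \<omega>)\<^sup>2 / 2) \<longleftrightarrow> \<bar>X i \<omega>\<bar> \<le> t i"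
        using ne by auto
      have "(X i \<omega>)\<^sup>2 \<noteq> (t i)\<^sup>2" using w(2) i by (simp add: power2_eq_iff)
      then have "exp (- (X i \<omega>)\<^sup>2 / 2) \<noteq> exp (- (t i)\<^sup>2 / 2)" by simp
      from step_poly_tendsto[OF _ _ _ _ this] ti show ?thesis unfolding iff by simp
    qed
    then have "(\<lambda>m. ?f m \<omega>) \<longlonglongrightarrow> (\<Prod>i\<in>S. if \<bar>X i \<omega>\<bar> \<le> t i then 1 else 0)"
      by (intro tendsto_prod)
    also have "(\<Prod>i\<in>S. if \<bar>X i \<omega>\<bar> \<le> t i then 1 else 0) = (indicator ?E \<omega> :: real)"
      using w(1) finS by (auto simp: indicator_def)
    finally show ?thesis .
  qed
  have "(\<lambda>m. integral\<^sup>L M (?f m)) \<longlonglongrightarrow> (\<integral>\<omega>. indicator ?E \<omega> \<partial>M)"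
  proof (rule integral_dominated_convergence[where w = "\<lambda>_. 1"])
    show "AE \<omega> in M. (\<lambda>m. ?f m \<omega>) \<longlonglongrightarrow> indicator ?E \<omega>"
      using ae AE_space by eventually_elim (rule lim)
    show "AE \<omega> in M. norm (?f m \<omega>) \<le> 1" for m
    proof (intro AE_I2)
      fix \<omega>
      have "0 \<le> ?f m \<omega>" by (intro prod_nonneg) (simp add: poly_step_poly_bounds)
      moreover have "?f m \<omega> \<le> 1" by (intro prod_le_1) (simp add: poly_step_poly_bounds)
      ultimately show "norm (?f m \<omega>) \<le> 1" by simp
    qed
  qed (use E fm in auto)
  then show ?thesis using E by (simp add: Int_absorb1 sets.sets_into_space)
qed

text \<open>
Both sides are limits of the two sides of \<open>correlation_increasing_poly\<close>, for steeper and steeper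
step polynomials.
\<close>
theorem gaussian_correlation:
  assumes P: "prob_space M" and dis: "A \<inter> B = {}" and X: "centered_gaussian_vector M (A \<union> B) X"
    and t: "\<And>i. i \<in> A \<union> B \<Longrightarrow> 0 < t i"
  shows "measure M {\<omega> \<in> space M. \<forall>i\<in>A. \<bar>X i \<omega>\<bar> \<le> t i} * measure M {\<omega> \<in> space M. \<forall>i\<in>B. \<bar>X i \<omega>\<bar> \<le> t i}
    \<le> measure M {\<omega> \<in> space M. \<forall>i\<in>A \<union> B. \<bar>X i \<omega>\<bar> \<le> t i}"
proof -
  obtain C where psd: "psd_on (A \<union> B) C" and char: "has_gauss_char M (A \<union> B) X C"
    using centered_gaussian_vector_char[OF P X] by blast
  have fin: "finite A" "finite B" using X unfolding centered_gaussian_vector_def by auto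
  note lim = integral_step_poly_tendsto[OF P X t]
  show ?thesis
  proof (rule LIMSEQ_le[OF tendsto_mult[OF lim lim] lim])
    show "\<exists>N. \<forall>m\<ge>N. (\<integral>\<omega>. (\<Prod>i\<in>A. poly (step_poly (exp (- (t i)\<^sup>2 / 2)) m) (exp (- (X i \<omega>)\<^sup>2 / 2))) \<partial>M)
       * (\<integral>\<omega>. (\<Prod>i\<in>B. poly (step_poly (exp (- (t i)\<^sup>2 / 2)) m) (exp (- (X i \<omega>)\<^sup>2 / 2))) \<partial>M)
      \<le> (\<integral>\<omega>. (\<Prod>i\<in>A \<union> B. poly (step_poly (exp (- (t i)\<^sup>2 / 2)) m) (exp (- (X i \<omega>)\<^sup>2 / 2))) \<partial>M)"
      by (intro exI allI impI correlation_increasing_poly[OF P fin dis psd char]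
          increasing_poly_step_poly)
  qed auto
qed

theorem theorem2:
  fixes M :: "'a measure" and X :: "nat \<Rightarrow> 'a \<Rightarrow> real" and t :: "nat \<Rightarrow> real"
    and n n1 n2 :: nat
  assumes "prob_space M"
    and "n1 \<ge> 1" and "n2 \<ge> 1" and "n = n1 + n2"
    and "centered_gaussian_vector M {1..n} X"
    and "\<And>i. i \<in> {1..n} \<Longrightarrow> t i > 0"
  shows "measure M {\<omega> \<in> space M. \<forall>i\<in>{1..n}. \<bar>X i \<omega>\<bar> \<le> t i}
    \<ge> measure M {\<omega> \<in> space M. \<forall>i\<in>{1..n1}. \<bar>X i \<omega>\<bar> \<le> t i}
      * measure M {\<omega> \<in> space M. \<forall>i\<in>{n1+1..n}. \<bar>X i \<omega>\<bar> \<le> t i}"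
proof -
  have split: "{1..n} = {1..n1} \<union> {n1+1..n}" using assms(4) by auto
  show ?thesis
    using assms(1,5,6) unfolding split by (intro gaussian_correlation) auto
qed

end
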